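(* Let $\phi:G\to H$ be a homomorphism between two Riemannian Lie groups. Suppose that $\phi$ is a Riemannian immersion, that the Lie algebras $\mathfrak g$ of $G$ and $\mathfrak h$ of $H$ are both unimodular, and that $\dim H=\dim G+1$. Then $\phi$ is harmonic.
   Context: All Lie groups are real and connected. A Riemannian Lie group is a Lie group with a left invariant Riemannian metric. A Lie algebra $\mathfrak g$ is unimodular if $\mathrm{tr}(\mathrm{ad}_u)=0$ for all $u\in\mathfrak g$. A Riemannian immersion is an isometric immersion. A smooth map $\phi:(M,g)\to(N,h)$ of Riemannian manifolds is harmonic if its tension field $\tau(\phi)=\mathrm{tr}_g\nabla d\phi$ vanishes. *)

theory Defs
  imports "HOL-Analysis.Analysis" "HOL-Algebra.Group"
begin

section \<open>Smooth manifolds\<close>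

text \<open>
  Model spaces are finite-dimensional spaces of class \<open>real_inner\<close> (finiteness is part of
  \<open>smooth_atlas\<close>) and not of class \<open>euclidean_space\<close>, because the latter
  excludes dimension zero. The inner product of the model space has no geometric role: Riemannian
  metrics are separate data.
\<close>

text \<open>
  \<open>k\<close>-fold continuous differentiability on an open set. Asking for directional derivatives
  of the derivative, rather than the derivative as an operator, is adequate since the model spaces
  have finite dimension.
\<close>

primrec C_k_on :: "nat \<Rightarrow> ('e::real_normed_vector \<Rightarrow> 'f::real_normed_vector) \<Rightarrow> 'e set \<Rightarrow> bool" where
  "C_k_on 0 f S \<longleftrightarrow> continuous_on S f"
| "C_k_on (Suc k) f S \<longleftrightarrow>
     (\<forall>x\<in>S. f differentiable (at x)) \<and>
     (\<forall>v. C_k_on k (\<lambda>x. frechet_derivative f (at x) v) S)"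

definition smooth_on :: "('e::real_normed_vector \<Rightarrow> 'f::real_normed_vector) \<Rightarrow> 'e set \<Rightarrow> bool" where
  "smooth_on f S \<longleftrightarrow> (\<forall>k. C_k_on k f S)"

text \<open>A chart is a domain together with a coordinate map, of which only the values on the domain
  matter.\<close>

type_synonym ('a, 'e) chart = "'a set \<times> ('a \<Rightarrow> 'e)"

abbreviation chart_inv :: "('a, 'e) chart \<Rightarrow> 'e \<Rightarrow> 'a" where
  "chart_inv C \<equiv> inv_into (fst C) (snd C)"

definition is_chart :: "('a::topological_space, 'e::real_inner) chart \<Rightarrow> bool" where
  "is_chart C \<longleftrightarrow> open (fst C) \<and> open (snd C ` fst C) \<and>
     homeomorphism (fst C) (snd C ` fst C) (snd C) (chart_inv C)"

abbreviation local_rep ::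
    "('a, 'e) chart \<Rightarrow> ('b, 'f) chart \<Rightarrow> ('a \<Rightarrow> 'b) \<Rightarrow> 'e \<Rightarrow> 'f" where
  "local_rep C D \<phi> \<equiv> snd D \<circ> \<phi> \<circ> chart_inv C"

text \<open>A smooth atlas, not required to be maximal, on the Hausdorff second countable space
  \<open>UNIV :: 'a set\<close>.\<close>

definition smooth_atlas ::
    "('a::{t2_space, second_countable_topology}, 'e::real_inner) chart set \<Rightarrow> bool" where
  "smooth_atlas A \<longleftrightarrow>
     (\<exists>B::'e set. finite B \<and> span B = UNIV) \<and>
     (\<forall>C\<in>A. is_chart C) \<and>
     (\<Union>C\<in>A. fst C) = UNIV \<and>
     (\<forall>C\<in>A. \<forall>D\<in>A. smooth_on (local_rep C D id) (snd C ` (fst C \<inter> fst D)))"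

definition smooth_map ::
    "('a::topological_space, 'e::real_inner) chart set \<Rightarrow>
     ('b::topological_space, 'f::real_inner) chart set \<Rightarrow> ('a \<Rightarrow> 'b) \<Rightarrow> bool" where
  "smooth_map A B \<phi> \<longleftrightarrow> continuous_on UNIV \<phi> \<and>
     (\<forall>C\<in>A. \<forall>D\<in>B. smooth_on (local_rep C D \<phi>) (snd C ` (fst C \<inter> \<phi> -` fst D)))"

definition prod_atlas ::
    "('a, 'e) chart set \<Rightarrow> ('b, 'f) chart set \<Rightarrow> ('a \<times> 'b, 'e \<times> 'f) chart set" where
  "prod_atlas A B = {(fst C \<times> fst D, map_prod (snd C) (snd D)) | C D. C \<in> A \<and> D \<in> B}"


section \<open>Tangent vectors, vector fields and metrics\<close>

text \<open>
  The tangent space at \<open>p\<close> is represented by the model space \<open>'e\<close>: a vector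
  stands for the tangent vector that has these coordinates in the chart \<open>chart_at A p\<close>,
  chosen once and for all. Coordinates in other charts are obtained from the derivatives of the
  coordinate changes. Since \<open>chart_at A p\<close> varies arbitrarily with \<open>p\<close>,
  smoothness of fields must be, and is, expressed in a fixed chart.
\<close>

definition chart_at :: "('a, 'e) chart set \<Rightarrow> 'a \<Rightarrow> ('a, 'e) chart" where
  "chart_at A p = (SOME C. C \<in> A \<and> p \<in> fst C)"

definition coord_at :: "('a, 'e) chart set \<Rightarrow> 'a \<Rightarrow> 'e" where
  "coord_at A p = snd (chart_at A p) p"

definition differential ::
    "('a, 'e::real_inner) chart set \<Rightarrow> ('b, 'f::real_inner) chart set \<Rightarrow> ('a \<Rightarrow> 'b) \<Rightarrow> 'a \<Rightarrow> 'e \<Rightarrow> 'f" where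
  "differential A B \<phi> p =
     frechet_derivative (local_rep (chart_at A p) (chart_at B (\<phi> p)) \<phi>) (at (coord_at A p))"

text \<open>A vector field as a function of the coordinates \<open>y\<close> in the chart \<open>C\<close>.\<close>

definition field_in_chart ::
    "('a, 'e::real_inner) chart set \<Rightarrow> ('a \<Rightarrow> 'e) \<Rightarrow> ('a, 'e) chart \<Rightarrow> 'e \<Rightarrow> 'e" where
  "field_in_chart A X C y = (let p = chart_inv C y in
     frechet_derivative (local_rep (chart_at A p) C id) (at (coord_at A p)) (X p))"

definition lie_bracket ::
    "('a, 'e::real_inner) chart set \<Rightarrow> ('a \<Rightarrow> 'e) \<Rightarrow> ('a \<Rightarrow> 'e) \<Rightarrow> 'a \<Rightarrow> 'e" where
  "lie_bracket A X Y p =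
     (let C = chart_at A p; y = coord_at A p; X' = field_in_chart A X C; Y' = field_in_chart A Y C
      in frechet_derivative Y' (at y) (X' y) - frechet_derivative X' (at y) (Y' y))"

text \<open>The coefficients of \<open>g\<close> in the chart \<open>C\<close>: \<open>v\<close> and
  \<open>w\<close> are the coordinates, in \<open>C\<close>, of tangent vectors at
  \<open>chart_inv C y\<close>.\<close>

definition metric_in_chart ::
    "('a, 'e::real_inner) chart set \<Rightarrow> ('a \<Rightarrow> 'e \<Rightarrow> 'e \<Rightarrow> real) \<Rightarrow> ('a, 'e) chart \<Rightarrow> 'e \<Rightarrow> 'e \<Rightarrow> 'e \<Rightarrow> real" where
  "metric_in_chart A g C y v w = (let p = chart_inv C y;
       T = frechet_derivative (local_rep C (chart_at A p) id) (at y)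
     in g p (T v) (T w))"

definition riemannian_metric ::
    "('a, 'e::real_inner) chart set \<Rightarrow> ('a \<Rightarrow> 'e \<Rightarrow> 'e \<Rightarrow> real) \<Rightarrow> bool" where
  "riemannian_metric A g \<longleftrightarrow>
     (\<forall>p. bilinear (g p) \<and> (\<forall>v w. g p v w = g p w v) \<and> (\<forall>v. v \<noteq> 0 \<longrightarrow> 0 < g p v v)) \<and>
     (\<forall>C\<in>A. \<forall>v w. smooth_on (\<lambda>y. metric_in_chart A g C y v w) (snd C ` fst C))"

definition riemannian_immersion ::
    "('a::topological_space, 'e::real_inner) chart set \<Rightarrow> ('a \<Rightarrow> 'e \<Rightarrow> 'e \<Rightarrow> real) \<Rightarrow>
     ('b::topological_space, 'f::real_inner) chart set \<Rightarrow> ('b \<Rightarrow> 'f \<Rightarrow> 'f \<Rightarrow> real) \<Rightarrow> ('a \<Rightarrow> 'b) \<Rightarrow> bool" where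
  "riemannian_immersion A g B h \<phi> \<longleftrightarrow> smooth_map A B \<phi> \<and>
     (\<forall>p. inj (differential A B \<phi> p) \<and>
        (\<forall>v w. h (\<phi> p) (differential A B \<phi> p v) (differential A B \<phi> p w) = g p v w))"


section \<open>Harmonic maps\<close>

text \<open>
  The Levi-Civita connection in the chart \<open>C\<close>: for vector fields with coordinate
  expressions \<open>V\<close> and \<open>W\<close> one has
  \<open>(\<nabla>\<^sub>V W)(y) = DW(y) (V y) + christoffel A g C y (V y) (W y)\<close>. The defining
  equation is that of the Christoffel symbols of the first kind,
  \<open>2 g\<^sub>k\<^sub>l \<Gamma>\<^sup>k\<^sub>i\<^sub>j = \<partial>\<^sub>i g\<^sub>j\<^sub>l + \<partial>\<^sub>j g\<^sub>i\<^sub>l - \<partial>\<^sub>l g\<^sub>i\<^sub>j\<close>.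
\<close>

definition christoffel ::
    "('a, 'e::real_inner) chart set \<Rightarrow> ('a \<Rightarrow> 'e \<Rightarrow> 'e \<Rightarrow> real) \<Rightarrow> ('a, 'e) chart \<Rightarrow> 'e \<Rightarrow> 'e \<Rightarrow> 'e \<Rightarrow> 'e" where
  "christoffel A g C y v w = (let m = metric_in_chart A g C in
     THE z. \<forall>u. 2 * m y z u =
         frechet_derivative (\<lambda>x. m x w u) (at y) v
       + frechet_derivative (\<lambda>x. m x v u) (at y) w
       - frechet_derivative (\<lambda>x. m x v w) (at y) u)"

text \<open>
  The second fundamental form \<open>\<nabla>d\<phi>\<close> at \<open>p\<close>, that is
  \<open>(\<nabla>d\<phi>)(v, W) = \<nabla>\<^sup>\<phi>\<^sub>v (d\<phi> W) - d\<phi> (\<nabla>\<^sub>v W)\<close>, where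
  \<open>\<nabla>\<^sup>\<phi>\<close> is the pull-back of the Levi-Civita connection of \<open>h\<close> along
  \<open>\<phi>\<close> and \<open>W\<close> is the extension of \<open>w\<close> with constant coefficients in
  the chart at \<open>p\<close>. The first two summands are \<open>\<nabla>\<^sup>\<phi>\<^sub>v (d\<phi> W)\<close>.
\<close>

definition second_fundamental_form ::
    "('a, 'e::real_inner) chart set \<Rightarrow> ('a \<Rightarrow> 'e \<Rightarrow> 'e \<Rightarrow> real) \<Rightarrow>
     ('b, 'f::real_inner) chart set \<Rightarrow> ('b \<Rightarrow> 'f \<Rightarrow> 'f \<Rightarrow> real) \<Rightarrow> ('a \<Rightarrow> 'b) \<Rightarrow> 'a \<Rightarrow> 'e \<Rightarrow> 'e \<Rightarrow> 'f" where
  "second_fundamental_form A g B h \<phi> p v w =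
     (let C = chart_at A p; D = chart_at B (\<phi> p); x = coord_at A p;
          df = (\<lambda>y. frechet_derivative (local_rep C D \<phi>) (at y))
      in frechet_derivative (\<lambda>y. df y w) (at x) v
         + christoffel B h D (coord_at B (\<phi> p)) (df x v) (df x w)
         - df x (christoffel A g C x v w))"

definition orthonormal_basis :: "('e::real_vector \<Rightarrow> 'e \<Rightarrow> real) \<Rightarrow> 'e set \<Rightarrow> bool" where
  "orthonormal_basis b E \<longleftrightarrow> independent E \<and> span E = UNIV \<and>
     (\<forall>u\<in>E. \<forall>v\<in>E. b u v = (if u = v then 1 else 0))"

definition metric_trace ::
    "('e::real_vector \<Rightarrow> 'e \<Rightarrow> real) \<Rightarrow> ('e \<Rightarrow> 'e \<Rightarrow> 'f::real_vector) \<Rightarrow> 'f" where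
  "metric_trace b \<beta> = (let E = (SOME E. orthonormal_basis b E) in \<Sum>u\<in>E. \<beta> u u)"

definition tension_field ::
    "('a, 'e::real_inner) chart set \<Rightarrow> ('a \<Rightarrow> 'e \<Rightarrow> 'e \<Rightarrow> real) \<Rightarrow>
     ('b, 'f::real_inner) chart set \<Rightarrow> ('b \<Rightarrow> 'f \<Rightarrow> 'f \<Rightarrow> real) \<Rightarrow> ('a \<Rightarrow> 'b) \<Rightarrow> 'a \<Rightarrow> 'f" where
  "tension_field A g B h \<phi> p = metric_trace (g p) (second_fundamental_form A g B h \<phi> p)"

definition harmonic_map ::
    "('a::topological_space, 'e::real_inner) chart set \<Rightarrow> ('a \<Rightarrow> 'e \<Rightarrow> 'e \<Rightarrow> real) \<Rightarrow>
     ('b::topological_space, 'f::real_inner) chart set \<Rightarrow> ('b \<Rightarrow> 'f \<Rightarrow> 'f \<Rightarrow> real) \<Rightarrow> ('a \<Rightarrow> 'b) \<Rightarrow> bool" where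
  "harmonic_map A g B h \<phi> \<longleftrightarrow> smooth_map A B \<phi> \<and> (\<forall>p. tension_field A g B h \<phi> p = 0)"


section \<open>Riemannian Lie groups\<close>

definition lie_group ::
    "'a::{t2_space, second_countable_topology} monoid \<Rightarrow> ('a, 'e::real_inner) chart set \<Rightarrow> bool" where
  "lie_group G A \<longleftrightarrow> group G \<and> carrier G = UNIV \<and> smooth_atlas A \<and>
     smooth_map (prod_atlas A A) A (\<lambda>(x, y). x \<otimes>\<^bsub>G\<^esub> y) \<and>
     smooth_map A A (\<lambda>x. inv\<^bsub>G\<^esub> x)"

definition left_invariant_metric ::
    "'a monoid \<Rightarrow> ('a, 'e::real_inner) chart set \<Rightarrow> ('a \<Rightarrow> 'e \<Rightarrow> 'e \<Rightarrow> real) \<Rightarrow> bool" where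
  "left_invariant_metric G A g \<longleftrightarrow>
     (\<forall>x y v w. g (x \<otimes>\<^bsub>G\<^esub> y) (differential A A (\<lambda>z. x \<otimes>\<^bsub>G\<^esub> z) y v)
                               (differential A A (\<lambda>z. x \<otimes>\<^bsub>G\<^esub> z) y w) = g y v w)"

definition riemannian_lie_group ::
    "'a::{t2_space, second_countable_topology} monoid \<Rightarrow> ('a, 'e::real_inner) chart set \<Rightarrow>
     ('a \<Rightarrow> 'e \<Rightarrow> 'e \<Rightarrow> real) \<Rightarrow> bool" where
  "riemannian_lie_group G A g \<longleftrightarrow> lie_group G A \<and> connected (UNIV :: 'a set) \<and>
     riemannian_metric A g \<and> left_invariant_metric G A g"

text \<open>The Lie algebra is the tangent space at the unit, with the bracket of left invariant vector
  fields.\<close>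

definition left_invariant_field :: "'a monoid \<Rightarrow> ('a, 'e::real_inner) chart set \<Rightarrow> 'e \<Rightarrow> 'a \<Rightarrow> 'e" where
  "left_invariant_field G A u x = differential A A (\<lambda>y. x \<otimes>\<^bsub>G\<^esub> y) \<one>\<^bsub>G\<^esub> u"

definition lie_ad :: "'a monoid \<Rightarrow> ('a, 'e::real_inner) chart set \<Rightarrow> 'e \<Rightarrow> 'e \<Rightarrow> 'e" where
  "lie_ad G A u v =
     lie_bracket A (left_invariant_field G A u) (left_invariant_field G A v) \<one>\<^bsub>G\<^esub>"

definition linear_trace :: "('e::real_vector \<Rightarrow> 'e) \<Rightarrow> real" where
  "linear_trace f = (let B = (SOME B. independent B \<and> span B = UNIV) in
     \<Sum>b\<in>B. representation B (f b) b)"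

definition unimodular :: "'a monoid \<Rightarrow> ('a, 'e::real_inner) chart set \<Rightarrow> bool" where
  "unimodular G A \<longleftrightarrow> (\<forall>u. linear_trace (lie_ad G A u) = 0)"

end

theory Submission
  imports Defs
begin

text \<open>
  Left invariant fields \<open>X\<^sub>u\<close> on \<open>G\<close> are \<open>\<phi>\<close>-related to left invariant fields on \<open>H\<close>, so along them
  \<open>\<nabla>d\<phi>(X, X) = \<nabla>\<^sub>Y Y - d\<phi>(\<nabla>\<^sub>X X)\<close> with \<open>Y = d\<phi> X\<close>, and the Koszul formula for left invariant fields is
  \<open>\<langle>\<nabla>\<^sub>Y Y, Z\<rangle> = \<langle>Y, [Z, Y]\<rangle>\<close>. For \<open>Z\<close> tangent to the image the two contributions cancel, since
  \<open>d\<phi>\<close> is an isometry onto its image and preserves brackets. For the unit normal \<open>n\<close>, unique up to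
  sign because the codimension is one, the second term vanishes, and summing the first one over an
  orthonormal basis of the image gives \<open>tr(ad\<^sub>n) - \<langle>n, [n, n]\<rangle> = tr(ad\<^sub>n) = 0\<close>.
\<close>

section \<open>Finite-dimensional inner products\<close>

text \<open>Traces are taken in the tangent space at \<open>p\<close>, brackets and unimodularity
  live at the units, and tangent vectors are coordinates in charts that vary arbitrarily with the
  point. Left invariant fields link \<open>p\<close> to the unit: they realise every tangent vector
  at \<open>p\<close>, have constant products, and their brackets are again left invariant. The
  choice of charts is tamed by stating each relation between fields pointwise and then carrying it
  to the two charts fixed at \<open>p\<close> and \<open>\<phi> p\<close>; there it holds on an open
  set and may be differentiated. Differentiating \<open>d\<phi> X = Y\<close> in this way produces
  the second derivative of \<open>\<phi>\<close>, so the constant-coefficient extension in the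
  second fundamental form can be replaced by a left invariant one. A trace sees only the diagonal,
  hence only covariant derivatives of a field along itself are computed.\<close>

definition inner_form :: "('e::real_vector \<Rightarrow> 'e \<Rightarrow> real) \<Rightarrow> bool" where
  "inner_form b \<longleftrightarrow> bilinear b \<and> (\<forall>v w. b v w = b w v) \<and> (\<forall>v. v \<noteq> 0 \<longrightarrow> 0 < b v v)"

text \<open>Spanning is left out on purpose: the image of an orthonormal basis under the immersion
  spans only a hyperplane and has to be completed.\<close>

definition orthonormal_set :: "('e::real_vector \<Rightarrow> 'e \<Rightarrow> real) \<Rightarrow> 'e set \<Rightarrow> bool" where
  "orthonormal_set b E \<longleftrightarrow> (\<forall>u\<in>E. \<forall>v\<in>E. b u v = (if u = v then 1 else 0))"

lemma inner_form_inner: "inner_form (inner :: 'e::real_inner \<Rightarrow> 'e \<Rightarrow> real)"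
  unfolding inner_form_def bilinear_def
  by (auto simp: inner_commute intro!: linearI inner_add_left inner_add_right)

context
  fixes b :: "'e::real_vector \<Rightarrow> 'e \<Rightarrow> real"
  assumes b: "inner_form b"
begin

lemma inner_form_bilinear: "bilinear b" and inner_form_commute: "b v w = b w v"
  and inner_form_pos: "v \<noteq> 0 \<Longrightarrow> 0 < b v v"
  using b unfolding inner_form_def by auto

lemma inner_form_linear: "linear (b v)" "linear (\<lambda>u. b u v)"
  using inner_form_bilinear by (auto simp: bilinear_def)

lemmas inner_form_simps =
  linear_add[OF inner_form_linear(1)] linear_add[OF inner_form_linear(2)]
  linear_diff[OF inner_form_linear(1)] linear_diff[OF inner_form_linear(2)]
  linear_cmul[OF inner_form_linear(1)] linear_cmul[OF inner_form_linear(2)]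
  linear_sum[OF inner_form_linear(1)] linear_sum[OF inner_form_linear(2)]
  linear_0[OF inner_form_linear(1)] linear_0[OF inner_form_linear(2)]

lemma inner_form_eq_0: "(\<And>v. b w v = 0) \<Longrightarrow> w = 0"
  using inner_form_pos[of w] by fastforce

lemma inner_form_span_eq_0:
  assumes "\<And>e. e \<in> E \<Longrightarrow> b w e = 0" "u \<in> span E"
  shows "b w u = 0"
  using assms(2) by (induction rule: span_induct_alt) (auto simp: inner_form_simps assms(1))

lemma orthonormal_residual:
  assumes "finite E" "orthonormal_set b E" "e \<in> E"
  shows "b (v - (\<Sum>u\<in>E. b v u *\<^sub>R u)) e = 0"
proof -
  have "(\<Sum>u\<in>E. b v u * b u e) = (\<Sum>u\<in>E. if u = e then b v u else 0)"
    using assms by (intro sum.cong) (auto simp: orthonormal_set_def)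
  then show ?thesis using assms by (simp add: inner_form_simps)
qed

text \<open>The residual lies in \<open>span E\<close> and is orthogonal to \<open>E\<close>, hence
  to itself.\<close>

lemma orthonormal_expansion:
  assumes "finite E" "orthonormal_set b E" "v \<in> span E"
  shows "v = (\<Sum>e\<in>E. b v e *\<^sub>R e)"
proof -
  let ?w = "v - (\<Sum>e\<in>E. b v e *\<^sub>R e)"
  have "?w \<in> span E"
    using assms(3) by (intro span_diff span_sum span_scale) (auto intro: span_base)
  then have "b ?w ?w = 0"
    by (rule inner_form_span_eq_0[rotated]) (rule orthonormal_residual[OF assms(1,2)])
  then have "?w = 0" using inner_form_pos by fastforce
  then show ?thesis by simp
qed

text \<open>A vector in the span of the others would be orthogonal to itself, against
  \<open>b e e = 1\<close>.\<close>

lemma orthonormal_independent: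
  assumes "orthonormal_set b E"
  shows "independent E"
proof
  assume "dependent E"
  then obtain e where e: "e \<in> E" "e \<in> span (E - {e})" unfolding dependent_def by blast
  have "b e e = 0"
    by (rule inner_form_span_eq_0[OF _ e(2)]) (use assms e in \<open>auto simp: orthonormal_set_def\<close>)
  then show False using assms e by (auto simp: orthonormal_set_def)
qed

text \<open>One Gram-Schmidt step: remove from \<open>z\<close> its projection to
  \<open>span E\<close>, then normalise.\<close>

lemma orthonormal_extend:
  assumes E: "finite E" "orthonormal_set b E" and z: "z \<notin> span E"
  obtains n where "n \<notin> E" "orthonormal_set b (insert n E)" "\<And>e. e \<in> E \<Longrightarrow> b n e = 0"
    "span (insert n E) = span (insert z E)"
proof -
  define s where "s = (\<Sum>e\<in>E. b z e *\<^sub>R e)"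
  define w where "w = z - s"
  define n where "n = (1 / sqrt (b w w)) *\<^sub>R w"
  have s: "s \<in> span E" unfolding s_def by (intro span_sum span_scale) (auto intro: span_base)
  have w0: "w \<noteq> 0" using z s unfolding w_def by auto
  then have pos: "b w w > 0" by (rule inner_form_pos)
  have "b w e = 0" if "e \<in> E" for e
    using orthonormal_residual[OF E that] unfolding w_def s_def .
  then have ne: "b n e = 0" if "e \<in> E" for e
    using that unfolding n_def by (simp add: inner_form_simps)
  have nn: "b n n = 1"
    using pos unfolding n_def by (simp add: inner_form_simps power2_eq_square[symmetric])
  have "n \<notin> E"
    using ne nn by fastforce
  moreover have "orthonormal_set b (insert n E)"
    unfolding orthonormal_set_def
  proof (intro ballI)
    fix u v assume "u \<in> insert n E" "v \<in> insert n E"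
    then show "b u v = (if u = v then 1 else 0)"
      using E(2) ne nn \<open>n \<notin> E\<close> inner_form_commute[of u n] by (auto simp: orthonormal_set_def)
  qed
  moreover have "span (insert n E) = span (insert z E)"
  proof
    have "s \<in> span (insert z E)" using s span_mono[of E "insert z E"] by auto
    then have "n \<in> span (insert z E)" unfolding n_def w_def
      by (intro span_scale span_diff) (auto intro: span_base)
    then have "insert n E \<subseteq> span (insert z E)" by (auto intro: span_base)
    then show "span (insert n E) \<subseteq> span (insert z E)" by (rule span_minimal) simp
    have "z = sqrt (b w w) *\<^sub>R n + s" using pos unfolding n_def w_def by simp
    moreover have "s \<in> span (insert n E)" using s span_mono[of E "insert n E"] by auto
    ultimately have "z \<in> span (insert n E)"
      by (metis insertI1 span_add span_base span_scale)
    then have "insert z E \<subseteq> span (insert n E)" by (auto intro: span_base)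
    then show "span (insert z E) \<subseteq> span (insert n E)" by (rule span_minimal) simp
  qed
  ultimately show ?thesis using that ne by blast
qed

text \<open>Gram-Schmidt along \<open>S\<close>. Vectors already in the span are skipped, so
  \<open>S\<close> may be dependent.\<close>

lemma orthonormal_set_exists:
  assumes "finite S"
  shows "\<exists>E. finite E \<and> orthonormal_set b E \<and> span E = span S"
  using assms
proof induction
  case empty
  show ?case by (intro exI[of _ "{}"]) (auto simp: orthonormal_set_def)
next
  case (insert z S)
  then obtain E where E: "finite E" "orthonormal_set b E" "span E = span S" by blast
  have eq: "span (insert z E) = span (insert z S)" using E(3) by (simp add: span_insert)
  show ?case
  proof (cases "z \<in> span E")
    case True
    then show ?thesis using E eq by (metis span_redundant)
  next
    case False
    then show ?thesis using orthonormal_extend[OF E(1,2) False] E(1) eq by (metis finite_insert)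
  qed
qed

end

lemma orthonormal_basis_iff:
  "inner_form b \<Longrightarrow> orthonormal_basis b E \<longleftrightarrow> orthonormal_set b E \<and> span E = UNIV"
  using orthonormal_independent unfolding orthonormal_basis_def orthonormal_set_def by blast

section \<open>Dimension, traces and duality\<close>

definition finite_dim :: "'e::real_vector itself \<Rightarrow> bool" where
  "finite_dim T \<longleftrightarrow> (\<exists>B::'e set. finite B \<and> span B = UNIV)"

lemma finite_dim_independent:
  assumes "finite_dim TYPE('e::real_vector)" "independent (E::'e set)"
  shows "finite E" "card E \<le> dim (UNIV::'e set)"
proof -
  obtain B::"'e set" where B: "finite B" "span B = UNIV" using assms unfolding finite_dim_def by auto
  then show "finite E" using independent_span_bound[OF B(1) assms(2)] by auto
  \<comment> \<open>\<open>B\<close> may be dependent; only a basis extracted from it has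
    \<open>dim\<close> elements.\<close>
  obtain B' where B': "B' \<subseteq> B" "independent B'" "span B' = span B"
    by (metis maximal_independent_subset span_minimal span_mono subset_antisym subspace_span)
  then have "dim (UNIV::'e set) = card B'" using B by (metis dim_eq_card span_UNIV)
  moreover have "finite B'" using B'(1) B(1) by (rule finite_subset)
  ultimately show "card E \<le> dim (UNIV::'e set)"
    using independent_span_bound[OF _ assms(2), of B'] B' B by auto
qed

lemma finite_dim_orthonormal_basis:
  assumes "finite_dim TYPE('e::real_vector)" "inner_form (b :: 'e \<Rightarrow> 'e \<Rightarrow> real)"
  obtains E where "finite E" "orthonormal_basis b E"
  using assms orthonormal_set_exists[of b] orthonormal_basis_iff[of b] unfolding finite_dim_def by metis

lemma orthonormal_basis_sum:
  assumes "inner_form b" "finite E" "orthonormal_basis b E"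
  shows "(\<Sum>e\<in>E. b v e *\<^sub>R e) = v"
  using orthonormal_expansion[of b E v] assms unfolding orthonormal_basis_iff[OF assms(1)] by auto

text \<open>\<open>linear_trace\<close> uses an arbitrary basis \<open>B\<close>. Expanding its
  vectors in \<open>E\<close> gives a double sum; summed in the other order, it contains the
  expansion of \<open>f e\<close> in \<open>B\<close>, which collapses.\<close>

lemma linear_trace_orthonormal:
  assumes fd: "finite_dim TYPE('e::real_vector)" and b: "inner_form (b :: 'e \<Rightarrow> 'e \<Rightarrow> real)"
    and E: "orthonormal_basis b E" and f: "linear f"
  shows "linear_trace f = (\<Sum>e\<in>E. b e (f e))"
proof -
  define B :: "'e set" where "B = (SOME B. independent B \<and> span B = UNIV)"
  have "\<exists>B::'e set. independent B \<and> span B = UNIV" using E unfolding orthonormal_basis_def by blast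
  then have B: "independent B" "span B = UNIV" unfolding B_def by (metis (mono_tags, lifting) someI_ex)+
  have fin: "finite B" "finite E"
    using finite_dim_independent[OF fd] B E by (auto simp: orthonormal_basis_def)
  have lr: "linear (\<lambda>v. representation B v c)" for c
    using B by (intro linearI) (simp_all add: representation_add representation_scale)
  have "linear_trace f = (\<Sum>c\<in>B. representation B (f c) c)"
    unfolding linear_trace_def B_def[symmetric] Let_def by simp
  also have "\<dots> = (\<Sum>c\<in>B. representation B (f (\<Sum>e\<in>E. b c e *\<^sub>R e)) c)"
    using orthonormal_basis_sum[OF b fin(2) E] by simp
  also have "\<dots> = (\<Sum>c\<in>B. \<Sum>e\<in>E. b c e * representation B (f e) c)"
    by (simp add: linear_sum[OF f] linear_cmul[OF f] linear_sum[OF lr] linear_cmul[OF lr])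
  also have "\<dots> = (\<Sum>e\<in>E. \<Sum>c\<in>B. representation B (f e) c * b c e)"
    by (subst sum.swap) (simp add: mult.commute)
  also have "\<dots> = (\<Sum>e\<in>E. b (\<Sum>c\<in>B. representation B (f e) c *\<^sub>R c) e)"
    by (simp add: inner_form_simps[OF b])
  also have "\<dots> = (\<Sum>e\<in>E. b e (f e))"
    using B fin by (simp add: sum_representation_eq inner_form_commute[OF b])
  finally show ?thesis .
qed

text \<open>The basis selected by \<open>SOME\<close> is itself orthonormal, so existence is enough
  and traces over different bases need not be compared.\<close>

lemma metric_trace_orthonormal:
  assumes "finite_dim TYPE('e::real_vector)" "inner_form (b :: 'e \<Rightarrow> 'e \<Rightarrow> real)"
  obtains E where "finite E" "orthonormal_basis b E"
    "metric_trace b \<beta> = (\<Sum>e\<in>E. \<beta> e e)"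
proof -
  have ex: "\<exists>E. orthonormal_basis b E" by (metis assms finite_dim_orthonormal_basis)
  define E where "E = (SOME E. orthonormal_basis b E)"
  have E: "orthonormal_basis b E" unfolding E_def by (rule someI_ex[OF ex])
  have "finite E" using E finite_dim_independent[OF assms(1)] by (auto simp: orthonormal_basis_def)
  then show ?thesis using that[of E] E unfolding metric_trace_def E_def Let_def by simp
qed

text \<open>This makes the description of \<open>christoffel\<close> by \<open>THE\<close>
  meaningful.\<close>

lemma riesz_representation:
  assumes fd: "finite_dim TYPE('e::real_vector)" and b: "inner_form (b :: 'e \<Rightarrow> 'e \<Rightarrow> real)" and l: "linear l"
  shows "\<exists>!z. \<forall>u. b z u = l u"
proof -
  obtain E where E: "finite E" "orthonormal_basis b E"
    using finite_dim_orthonormal_basis[OF fd b] .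
  show ?thesis
  proof (rule ex1I[of _ "\<Sum>e\<in>E. l e *\<^sub>R e"])
    show "\<forall>u. b (\<Sum>e\<in>E. l e *\<^sub>R e) u = l u"
    proof
      fix u
      have "l u = l (\<Sum>e\<in>E. b u e *\<^sub>R e)" using orthonormal_basis_sum[OF b E] by simp
      also have "\<dots> = (\<Sum>e\<in>E. b u e * l e)" by (simp add: linear_sum[OF l] linear_cmul[OF l])
      also have "\<dots> = b (\<Sum>e\<in>E. l e *\<^sub>R e) u"
        by (simp add: inner_form_simps[OF b] mult.commute inner_form_commute[OF b])
      finally show "b (\<Sum>e\<in>E. l e *\<^sub>R e) u = l u" by simp
    qed
    fix z assume z: "\<forall>u. b z u = l u"
    then show "z = (\<Sum>e\<in>E. l e *\<^sub>R e)" using orthonormal_basis_sum[OF b E, of z] by simp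
  qed
qed

lemma orthonormal_unit_normal:
  assumes fd: "finite_dim TYPE('f::real_vector)" and b: "inner_form (b :: 'f \<Rightarrow> 'f \<Rightarrow> real)"
    and E: "orthonormal_set b E" "dim (UNIV::'f set) = card E + 1"
  obtains n where "n \<notin> E" "\<And>e. e \<in> E \<Longrightarrow> b n e = 0" "orthonormal_basis b (insert n E)"
proof -
  have fin: "finite E" using finite_dim_independent(1)[OF fd orthonormal_independent[OF b E(1)]] .
  have "span E \<noteq> UNIV"
  proof
    assume "span E = UNIV"
    then have "dim (UNIV::'f set) = card E"
      using orthonormal_independent[OF b E(1)] by (metis dim_eq_card span_UNIV)
    then show False using E(2) by simp
  qed
  then obtain z where "z \<notin> span E" by blast
  then obtain n where n: "n \<notin> E" "orthonormal_set b (insert n E)" "\<And>e. e \<in> E \<Longrightarrow> b n e = 0"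
    using orthonormal_extend[OF b fin E(1)] by metis
  have "span (insert n E) = UNIV"
  proof (rule ccontr)
    \<comment> \<open>Another extension would yield \<open>card E + 2\<close> independent vectors,
      one more than the dimension.\<close>
    assume "span (insert n E) \<noteq> UNIV"
    then obtain z' where "z' \<notin> span (insert n E)" by blast
    then obtain n' where n': "n' \<notin> insert n E" "orthonormal_set b (insert n' (insert n E))"
      using orthonormal_extend[OF b _ n(2)] fin by (metis finite_insert)
    have "card (insert n' (insert n E)) \<le> dim (UNIV::'f set)"
      using finite_dim_independent(2)[OF fd orthonormal_independent[OF b n'(2)]] .
    then show False using E(2) n'(1) n(1) fin by simp
  qed
  then show ?thesis using that n orthonormal_basis_iff[OF b] by blast
qed

section \<open>Calculus in coordinates\<close>

lemma frechet_derivativeI: "(f has_derivative f') (at x) \<Longrightarrow> frechet_derivative f (at x) = f'"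
  by (rule frechet_derivative_at[symmetric])

lemma differentiable_cong_open:
  assumes "open S" "x \<in> S" "\<And>y. y \<in> S \<Longrightarrow> f y = g y" "f differentiable (at x)"
  shows "g differentiable (at x)"
proof -
  obtain f' where "(f has_derivative f') (at x)" using assms(4) by (auto simp: differentiable_def)
  then have "(g has_derivative f') (at x)"
    by (rule has_derivative_transform_within_open[OF _ assms(1,2)]) (rule assms(3))
  then show ?thesis by (auto simp: differentiable_def)
qed

text \<open>On an open set, equal functions have equal derivatives, so the induction can pass to
  them.\<close>

lemma C_k_on_cong:
  assumes "open S" "\<And>x. x \<in> S \<Longrightarrow> f x = g x" "C_k_on k f S"
  shows "C_k_on k g S"
  using assms(2,3)
proof (induction k arbitrary: f g)
  case 0
  then show ?case using continuous_on_cong[of S S f g] by simp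
next
  case (Suc k)
  note eq = Suc.prems(1)
  have df: "f differentiable (at x)" if "x \<in> S" for x using Suc.prems(2) that by simp
  have "frechet_derivative f (at x) = frechet_derivative g (at x)" if "x \<in> S" for x
    by (rule frechet_derivative_transform_within_open[OF df[OF that] assms(1) that eq])
  note fg = this
  have "C_k_on k (\<lambda>x. frechet_derivative g (at x) v) S" for v
    by (rule Suc.IH[of "\<lambda>x. frechet_derivative f (at x) v"]) (use Suc.prems(2) fg in auto)
  then show ?case
    using differentiable_cong_open[OF assms(1) _ eq df] by simp
qed

lemma C_k_on_inner_left:
  fixes f :: "'e::real_normed_vector \<Rightarrow> 'f::real_inner"
  assumes "open S" "C_k_on k f S"
  shows "C_k_on k (\<lambda>x. f x \<bullet> c) S"
  using assms(2)
proof (induction k arbitrary: f)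
  case 0
  then show ?case by (auto intro: continuous_intros)
next
  case (Suc k)
  have der: "((\<lambda>x. f x \<bullet> c) has_derivative (\<lambda>v. frechet_derivative f (at x) v \<bullet> c)) (at x)"
    if "x \<in> S" for x
    using Suc.prems that by (intro has_derivative_inner_left) (auto simp: frechet_derivative_works)
  have "C_k_on k (\<lambda>x. frechet_derivative (\<lambda>x. f x \<bullet> c) (at x) v) S" for v
    by (rule C_k_on_cong[OF assms(1) _ Suc.IH[of "\<lambda>x. frechet_derivative f (at x) v"]])
      (use Suc.prems frechet_derivativeI[OF der] in auto)
  then show ?case using der by (auto simp: differentiable_def)
qed

lemma C_k_on_SucD:
  assumes "C_k_on (Suc k) f S"
  shows "x \<in> S \<Longrightarrow> f differentiable (at x)" "C_k_on k (\<lambda>x. frechet_derivative f (at x) v) S"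
  using assms by auto

lemma has_derivative_slice:
  fixes f :: "'d::real_normed_vector \<times> 'e::real_normed_vector \<Rightarrow> 'f::real_normed_vector"
  assumes "f differentiable (at (s, t))"
  shows "((\<lambda>t. f (s, t)) has_derivative (\<lambda>v. frechet_derivative f (at (s, t)) (0, v))) (at t)"
proof -
  have "(Pair s has_derivative (\<lambda>v. (0, v))) (at t)"
    by (auto intro!: derivative_eq_intros)
  moreover have "(f has_derivative frechet_derivative f (at (s, t))) (at (s, t))"
    using assms by (simp add: frechet_derivative_works)
  ultimately show ?thesis by (rule has_derivative_compose)
qed

text \<open>Meant for the multiplication with its first factor held fixed: joint smoothness gives
  smoothness of left translations.\<close>

lemma C_k_on_slice:
  fixes f :: "'d::real_normed_vector \<times> 'e::real_normed_vector \<Rightarrow> 'f::real_normed_vector"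
  assumes "open S" "C_k_on k f S"
  shows "C_k_on k (\<lambda>t. f (s, t)) (Pair s -` S)"
  using assms(2)
proof (induction k arbitrary: f)
  case 0
  show ?case unfolding C_k_on.simps
    by (rule continuous_on_compose2[of S f]) (use 0 in \<open>auto intro!: continuous_intros\<close>)
next
  case (Suc k)
  have op: "open (Pair s -` S)" using assms(1) by (intro open_vimage continuous_intros)
  have der: "((\<lambda>t. f (s, t)) has_derivative (\<lambda>v. frechet_derivative f (at (s, t)) (0, v))) (at t)"
    if "(s, t) \<in> S" for t
    by (rule has_derivative_slice[OF C_k_on_SucD(1)[OF Suc.prems that]])
  have "C_k_on k (\<lambda>t. frechet_derivative (\<lambda>t. f (s, t)) (at t) v) (Pair s -` S)" for v
    by (rule C_k_on_cong[OF op _ Suc.IH[of "\<lambda>z. frechet_derivative f (at z) (0, v)"]])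
      (use Suc.prems frechet_derivativeI[OF der] in auto)
  then show ?case using der by (auto simp: differentiable_def)
qed

section \<open>Mean values and symmetry of second derivatives\<close>

lemma has_real_derivative_on_line:
  fixes F :: "'e::real_normed_vector \<Rightarrow> real"
  assumes "F differentiable (at (c + t *\<^sub>R u))"
  shows "((\<lambda>t. F (c + t *\<^sub>R u)) has_real_derivative frechet_derivative F (at (c + t *\<^sub>R u)) u) (at t)"
proof -
  have "((\<lambda>t. c + t *\<^sub>R u) has_derivative (\<lambda>k. k *\<^sub>R u)) (at t)"
    by (auto intro!: derivative_eq_intros)
  moreover have "(F has_derivative frechet_derivative F (at (c + t *\<^sub>R u))) (at (c + t *\<^sub>R u))"
    using assms by (simp add: frechet_derivative_works)
  ultimately have "((\<lambda>t. F (c + t *\<^sub>R u)) has_derivative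
      (\<lambda>k. frechet_derivative F (at (c + t *\<^sub>R u)) (k *\<^sub>R u))) (at t)"
    by (rule has_derivative_compose)
  moreover have "(\<lambda>k. frechet_derivative F (at (c + t *\<^sub>R u)) (k *\<^sub>R u)) =
      (\<lambda>k. frechet_derivative F (at (c + t *\<^sub>R u)) u * k)"
    by (intro ext) (simp add: linear_cmul[OF linear_frechet_derivative[OF assms]])
  ultimately show ?thesis by (simp add: has_field_derivative_def)
qed

text \<open>Two applications of the mean value theorem, along \<open>u\<close> and then along
  \<open>v\<close>, turn the second difference quotient into the mixed derivative at an intermediate
  point of the parallelogram. Continuity of that derivative gives the limit.\<close>

lemma second_difference_tendsto:
  fixes F :: "'e::real_normed_vector \<Rightarrow> real"
  assumes S: "open S" "x \<in> S" and F: "C_k_on (Suc (Suc 0)) F S"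
  shows "((\<lambda>s. (F (x + s *\<^sub>R u + s *\<^sub>R v) - F (x + s *\<^sub>R u) - F (x + s *\<^sub>R v) + F x) / s\<^sup>2)
    \<longlongrightarrow> frechet_derivative (\<lambda>y. frechet_derivative F (at y) u) (at x) v) (at_right 0)"
proof (rule tendstoI)
  fix e :: real assume e: "e > 0"
  define D where "D = (\<lambda>y. frechet_derivative F (at y) u)"
  define q where "q = (\<lambda>y. frechet_derivative D (at y) v)"
  have dF: "F differentiable (at y)" and dD: "D differentiable (at y)" if "y \<in> S" for y
    using F that unfolding D_def by auto
  have "continuous_on S q" using F unfolding q_def D_def by auto
  then have "q \<midarrow>x\<rightarrow> q x" using S by (simp add: continuous_on_eq_continuous_at isContD)
  then have "eventually (\<lambda>y. dist (q y) (q x) < e) (nhds x)"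
    using e by (auto simp: tendsto_iff eventually_at_filter elim!: eventually_mono)
  moreover have "eventually (\<lambda>y. y \<in> S) (nhds x)" using S by (simp add: eventually_nhds_in_open)
  ultimately obtain r where r: "r > 0" "\<And>y. dist y x < r \<Longrightarrow> dist (q y) (q x) < e \<and> y \<in> S"
    by (metis (mono_tags, lifting) eventually_conj eventually_nhds_metric)
  \<comment> \<open>This radius keeps the parallelogram with sides \<open>s u\<close> and
    \<open>s v\<close> inside the \<open>r\<close>-ball; the added 1 keeps the denominator positive
    when both vectors vanish.\<close>
  define \<delta> where "\<delta> = r / (norm u + norm v + 1)"
  have N: "norm u + norm v + 1 > 0" by (simp add: add_nonneg_pos)
  have "\<delta> > 0" unfolding \<delta>_def using r N by simp
  have near: "dist (x + a *\<^sub>R u + b *\<^sub>R v) x < r" if "0 \<le> a" "a \<le> s" "0 \<le> b" "b \<le> s" "s < \<delta>" for a b s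
  proof -
    have "dist (x + a *\<^sub>R u + b *\<^sub>R v) x = norm (a *\<^sub>R u + b *\<^sub>R v)"
      by (simp add: dist_norm algebra_simps)
    also have "\<dots> \<le> a * norm u + b * norm v"
      using norm_triangle_ineq[of "a *\<^sub>R u" "b *\<^sub>R v"] that by simp
    also have "\<dots> \<le> s * norm u + s * norm v"
      using that by (intro add_mono mult_right_mono) auto
    also have "\<dots> \<le> s * (norm u + norm v + 1)" using that by (simp add: algebra_simps)
    also have "\<dots> < \<delta> * (norm u + norm v + 1)" using that N by (intro mult_strict_right_mono)
    also have "\<dots> = r" using N by (simp add: \<delta>_def)
    finally show ?thesis .
  qed
  have "dist ((F (x + s *\<^sub>R u + s *\<^sub>R v) - F (x + s *\<^sub>R u) - F (x + s *\<^sub>R v) + F x) / s\<^sup>2) (q x) < e"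
    if s: "0 < s" "s < \<delta>" for s
  proof -
    \<comment> \<open>The second difference is the increment of \<open>?a\<close> from 0 to
      \<open>s\<close>, and \<open>?a\<close> is itself an increment of \<open>F\<close> by
      \<open>s v\<close>.\<close>
    let ?a = "\<lambda>t. F ((x + s *\<^sub>R v) + t *\<^sub>R u) - F (x + t *\<^sub>R u)"
    have mem: "x + a *\<^sub>R u + b *\<^sub>R v \<in> S" if "0 \<le> a" "a \<le> s" "0 \<le> b" "b \<le> s" for a b
      using near[OF that] r(2) s by blast
    have "(?a has_real_derivative D ((x + s *\<^sub>R v) + t *\<^sub>R u) - D (x + t *\<^sub>R u)) (at t)"
      if "0 \<le> t" "t \<le> s" for t
      unfolding D_def using mem[of t s] mem[of t 0] s that
      by (intro DERIV_diff has_real_derivative_on_line dF) (auto simp: algebra_simps)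
    from MVT2[OF s(1) this] obtain a where a: "0 < a" "a < s"
      "?a s - ?a 0 = (s - 0) * (D ((x + s *\<^sub>R v) + a *\<^sub>R u) - D (x + a *\<^sub>R u))" by blast
    have "((\<lambda>t. D ((x + a *\<^sub>R u) + t *\<^sub>R v)) has_real_derivative q ((x + a *\<^sub>R u) + t *\<^sub>R v)) (at t)"
      if "0 \<le> t" "t \<le> s" for t
      unfolding q_def using mem[of a t] a s that by (intro has_real_derivative_on_line dD) auto
    from MVT2[OF s(1) this] obtain b where b: "0 < b" "b < s"
      "D ((x + a *\<^sub>R u) + s *\<^sub>R v) - D (x + a *\<^sub>R u) = s * q ((x + a *\<^sub>R u) + b *\<^sub>R v)" by auto
    have swap: "(x + s *\<^sub>R v) + a *\<^sub>R u = (x + a *\<^sub>R u) + s *\<^sub>R v" by (simp add: algebra_simps)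
    have "?a s - ?a 0 = s\<^sup>2 * q (x + a *\<^sub>R u + b *\<^sub>R v)"
      unfolding a(3) swap b(3) by (simp add: power2_eq_square)
    moreover have "?a s - ?a 0 = F (x + s *\<^sub>R u + s *\<^sub>R v) - F (x + s *\<^sub>R u) - F (x + s *\<^sub>R v) + F x"
      by (simp add: algebra_simps)
    ultimately have "(F (x + s *\<^sub>R u + s *\<^sub>R v) - F (x + s *\<^sub>R u) - F (x + s *\<^sub>R v) + F x) / s\<^sup>2
        = q (x + a *\<^sub>R u + b *\<^sub>R v)"
      using s by (simp add: field_simps)
    then show ?thesis using near[of a s b] r(2) a b s by simp
  qed
  then show "eventually (\<lambda>s. dist ((F (x + s *\<^sub>R u + s *\<^sub>R v) - F (x + s *\<^sub>R u) - F (x + s *\<^sub>R v) + F x) / s\<^sup>2)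
      (frechet_derivative (\<lambda>y. frechet_derivative F (at y) u) (at x) v) < e) (at_right 0)"
    using \<open>\<delta> > 0\<close> unfolding q_def D_def eventually_at_right_field by auto
qed

text \<open>The second difference is symmetric in \<open>u\<close> and \<open>v\<close>, and limits
  at \<open>at_right 0\<close> are unique.\<close>

lemma frechet_derivative_symmetric_real:
  fixes F :: "'e::real_normed_vector \<Rightarrow> real"
  assumes "open S" "x \<in> S" "C_k_on (Suc (Suc 0)) F S"
  shows "frechet_derivative (\<lambda>y. frechet_derivative F (at y) u) (at x) v =
    frechet_derivative (\<lambda>y. frechet_derivative F (at y) v) (at x) u"
proof -
  have eq: "F (x + s *\<^sub>R v + s *\<^sub>R u) - F (x + s *\<^sub>R v) - F (x + s *\<^sub>R u) + F x =
    F (x + s *\<^sub>R u + s *\<^sub>R v) - F (x + s *\<^sub>R u) - F (x + s *\<^sub>R v) + F x" for s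
    by (simp add: algebra_simps)
  show ?thesis
    by (rule tendsto_unique[OF _ second_difference_tendsto[OF assms]
        second_difference_tendsto[OF assms, of v u, unfolded eq]]) simp
qed

text \<open>Inner products with a fixed \<open>c\<close> reduce this to real functions, and such
  products determine a vector.\<close>

lemma frechet_derivative_symmetric:
  fixes F :: "'e::real_normed_vector \<Rightarrow> 'f::real_inner"
  assumes S: "open S" "x \<in> S" and F: "C_k_on (Suc (Suc 0)) F S"
  shows "frechet_derivative (\<lambda>y. frechet_derivative F (at y) u) (at x) v =
    frechet_derivative (\<lambda>y. frechet_derivative F (at y) v) (at x) u"
proof -
  have *: "frechet_derivative (\<lambda>y. frechet_derivative (\<lambda>z. F z \<bullet> c) (at y) u) (at x) v =
     frechet_derivative (\<lambda>y. frechet_derivative F (at y) u) (at x) v \<bullet> c" for c u v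
  proof -
    have "((\<lambda>x. F x \<bullet> c) has_derivative (\<lambda>v. frechet_derivative F (at y) v \<bullet> c)) (at y)"
      if "y \<in> S" for y
      using F that by (intro has_derivative_inner_left) (auto simp: frechet_derivative_works)
    then have eq: "frechet_derivative (\<lambda>z. F z \<bullet> c) (at y) u = frechet_derivative F (at y) u \<bullet> c"
      if "y \<in> S" for y using frechet_derivativeI that by (metis (no_types, lifting))
    have "((\<lambda>y. frechet_derivative F (at y) u \<bullet> c) has_derivative
        (\<lambda>v. frechet_derivative (\<lambda>y. frechet_derivative F (at y) u) (at x) v \<bullet> c)) (at x)"
      using F S by (intro has_derivative_inner_left) (auto simp: frechet_derivative_works)
    then have "((\<lambda>y. frechet_derivative (\<lambda>z. F z \<bullet> c) (at y) u) has_derivative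
        (\<lambda>v. frechet_derivative (\<lambda>y. frechet_derivative F (at y) u) (at x) v \<bullet> c)) (at x)"
      by (rule has_derivative_transform_within_open[OF _ S]) (simp add: eq)
    from fun_cong[OF frechet_derivativeI[OF this], of v] show ?thesis .
  qed
  show ?thesis
    using frechet_derivative_symmetric_real[OF S C_k_on_inner_left[OF S(1) F]]
    unfolding * by (metis vector_eq_ldot inner_commute)
qed

section \<open>Product rules in finite dimension\<close>

text \<open>Only the values \<open>L y v\<close> for fixed \<open>v\<close>, not \<open>L\<close> as an operator-valued map, are known to be
  differentiable. In finite dimension this suffices, by expanding \<open>V\<close> in an orthonormal basis.\<close>

lemma has_derivative_linear_family:
  fixes L :: "'a::real_normed_vector \<Rightarrow> 'e::real_inner \<Rightarrow> 'g::real_normed_vector"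
  assumes fd: "finite_dim TYPE('e)" and S: "open S" "x \<in> S" and lin: "\<And>y. y \<in> S \<Longrightarrow> linear (L y)"
    and L: "\<And>v. (\<lambda>y. L y v) differentiable (at x)" and V: "V differentiable (at x)"
  shows "((\<lambda>y. L y (V y)) has_derivative
    (\<lambda>k. frechet_derivative (\<lambda>y. L y (V x)) (at x) k + L x (frechet_derivative V (at x) k))) (at x)"
proof -
  obtain E :: "'e set" where E: "finite E" "orthonormal_basis (\<bullet>) E"
    using finite_dim_orthonormal_basis[OF fd inner_form_inner] .
  have ex: "(\<Sum>e\<in>E. (y \<bullet> e) *\<^sub>R e) = y" for y
    by (rule orthonormal_basis_sum[OF inner_form_inner E])
  have expand: "L y w = (\<Sum>e\<in>E. (w \<bullet> e) *\<^sub>R L y e)" if "y \<in> S" for y w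
  proof -
    have "L y w = L y (\<Sum>e\<in>E. (w \<bullet> e) *\<^sub>R e)" by (simp add: ex)
    then show ?thesis by (simp only: linear_sum[OF lin[OF that]] linear_cmul[OF lin[OF that]])
  qed
  have gen: "((\<lambda>y. L y (W y)) has_derivative (\<lambda>k. (\<Sum>e\<in>E. (W x \<bullet> e) *\<^sub>R frechet_derivative (\<lambda>y. L y e) (at x) k)
      + L x (frechet_derivative W (at x) k))) (at x)" if W: "W differentiable (at x)" for W
  proof -
    have "((\<lambda>y. \<Sum>e\<in>E. (W y \<bullet> e) *\<^sub>R L y e) has_derivative
        (\<lambda>k. \<Sum>e\<in>E. (W x \<bullet> e) *\<^sub>R frechet_derivative (\<lambda>y. L y e) (at x) k
          + (frechet_derivative W (at x) k \<bullet> e) *\<^sub>R L x e)) (at x)"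
      using L W by (intro has_derivative_sum has_derivative_scaleR has_derivative_inner_left)
        (auto simp: frechet_derivative_works)
    then have "((\<lambda>y. \<Sum>e\<in>E. (W y \<bullet> e) *\<^sub>R L y e) has_derivative
        (\<lambda>k. (\<Sum>e\<in>E. (W x \<bullet> e) *\<^sub>R frechet_derivative (\<lambda>y. L y e) (at x) k)
          + L x (frechet_derivative W (at x) k))) (at x)"
      by (simp only: sum.distrib expand[OF S(2), symmetric])
    then show ?thesis
      by (rule has_derivative_transform_within_open[OF _ S]) (simp add: expand)
  qed
  \<comment> \<open>For the constant \<open>W = V x\<close> the second term is
    \<open>L x 0 = 0\<close>, so \<open>gen\<close> identifies the remaining sum with the derivative
    at frozen argument.\<close>
  have "frechet_derivative (\<lambda>y. L y (V x)) (at x) =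
      (\<lambda>k. (\<Sum>e\<in>E. (V x \<bullet> e) *\<^sub>R frechet_derivative (\<lambda>y. L y e) (at x) k))"
    using frechet_derivativeI[OF gen[of "\<lambda>_. V x"]] linear_0[OF lin[OF S(2)]] by simp
  then show ?thesis using gen[OF V] by simp
qed

lemma linear_frechet_derivative_family:
  fixes L :: "'a::real_normed_vector \<Rightarrow> 'e::real_vector \<Rightarrow> 'g::real_normed_vector"
  assumes S: "open S" "x \<in> S" and lin: "\<And>y. y \<in> S \<Longrightarrow> linear (L y)"
    and L: "\<And>v. (\<lambda>y. L y v) differentiable (at x)"
  shows "linear (\<lambda>v. frechet_derivative (\<lambda>y. L y v) (at x) k)"
proof (rule linearI)
  have der: "((\<lambda>y. L y v) has_derivative frechet_derivative (\<lambda>y. L y v) (at x)) (at x)" for v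
    using L by (simp add: frechet_derivative_works)
  fix v w c
  have "((\<lambda>y. L y (v + w)) has_derivative
      (\<lambda>k. frechet_derivative (\<lambda>y. L y v) (at x) k + frechet_derivative (\<lambda>y. L y w) (at x) k)) (at x)"
    by (rule has_derivative_transform_within_open[OF has_derivative_add[OF der der] S])
      (simp add: linear_add lin)
  then show "frechet_derivative (\<lambda>y. L y (v + w)) (at x) k =
      frechet_derivative (\<lambda>y. L y v) (at x) k + frechet_derivative (\<lambda>y. L y w) (at x) k"
    by (simp add: frechet_derivativeI)
  have "((\<lambda>y. L y (c *\<^sub>R v)) has_derivative (\<lambda>k. c *\<^sub>R frechet_derivative (\<lambda>y. L y v) (at x) k)) (at x)"
    by (rule has_derivative_transform_within_open[OF has_derivative_scaleR_right[OF der] S])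
      (simp add: linear_cmul lin)
  then show "frechet_derivative (\<lambda>y. L y (c *\<^sub>R v)) (at x) k =
      c *\<^sub>R frechet_derivative (\<lambda>y. L y v) (at x) k"
    by (simp add: frechet_derivativeI)
qed

lemma has_derivative_bilinear_family:
  fixes \<beta> :: "'a::real_normed_vector \<Rightarrow> 'e::real_inner \<Rightarrow> 'e \<Rightarrow> 'g::real_normed_vector"
  assumes fd: "finite_dim TYPE('e)" and S: "open S" "x \<in> S" and bil: "\<And>y. y \<in> S \<Longrightarrow> bilinear (\<beta> y)"
    and \<beta>: "\<And>v w. (\<lambda>y. \<beta> y v w) differentiable (at x)"
    and V: "V differentiable (at x)" and W: "W differentiable (at x)"
  shows "((\<lambda>y. \<beta> y (V y) (W y)) has_derivative
    (\<lambda>k. frechet_derivative (\<lambda>y. \<beta> y (V x) (W x)) (at x) k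
      + \<beta> x (frechet_derivative V (at x) k) (W x) + \<beta> x (V x) (frechet_derivative W (at x) k))) (at x)"
proof -
  have 1: "((\<lambda>y. \<beta> y (V y) w) has_derivative
    (\<lambda>k. frechet_derivative (\<lambda>y. \<beta> y (V x) w) (at x) k + \<beta> x (frechet_derivative V (at x) k) w)) (at x)" for w
    by (rule has_derivative_linear_family[OF fd S, where L = "\<lambda>y v. \<beta> y v w"])
      (use bil \<beta> V in \<open>auto simp: bilinear_def\<close>)
  then have d1: "(\<lambda>y. \<beta> y (V y) w) differentiable (at x)" for w
    unfolding differentiable_def by blast
  have "((\<lambda>y. \<beta> y (V y) (W y)) has_derivative (\<lambda>k. frechet_derivative (\<lambda>y. \<beta> y (V y) (W x)) (at x) k
      + \<beta> x (V x) (frechet_derivative W (at x) k))) (at x)"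
    by (rule has_derivative_linear_family[OF fd S, where L = "\<lambda>y. \<beta> y (V y)"])
      (use bil d1 W in \<open>auto simp: bilinear_def\<close>)
  then show ?thesis unfolding frechet_derivativeI[OF 1] .
qed

text \<open>Differentiate \<open>df(V) = W \<circ> f\<close> in direction \<open>k\<close>: the
  product rule on the left, the chain rule on the right.\<close>

lemma related_fields_derivative:
  fixes f :: "'e::real_inner \<Rightarrow> 'f::real_inner"
  assumes fd: "finite_dim TYPE('e)" and S: "open S" "x \<in> S" and f: "C_k_on (Suc (Suc 0)) f S"
    and V: "V differentiable (at x)" and W: "W differentiable (at (f x))"
    and rel: "\<And>y. y \<in> S \<Longrightarrow> frechet_derivative f (at y) (V y) = W (f y)"
  shows "frechet_derivative (\<lambda>y. frechet_derivative f (at y) (V x)) (at x) k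
      + frechet_derivative f (at x) (frechet_derivative V (at x) k)
    = frechet_derivative W (at (f x)) (frechet_derivative f (at x) k)"
proof -
  have df: "f differentiable (at y)" if "y \<in> S" for y using f that by simp
  have 1: "((\<lambda>y. frechet_derivative f (at y) (V y)) has_derivative
    (\<lambda>k. frechet_derivative (\<lambda>y. frechet_derivative f (at y) (V x)) (at x) k
      + frechet_derivative f (at x) (frechet_derivative V (at x) k))) (at x)"
    by (rule has_derivative_linear_family[where L = "\<lambda>y. frechet_derivative f (at y)", OF fd S _ _ V])
      (use f S linear_frechet_derivative[OF df] in auto)
  have "((\<lambda>y. W (f y)) has_derivative
      (\<lambda>k. frechet_derivative W (at (f x)) (frechet_derivative f (at x) k))) (at x)"
    by (rule has_derivative_compose[of f])
      (use df[OF S(2)] W in \<open>auto simp: frechet_derivative_works\<close>)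
  then have "((\<lambda>y. frechet_derivative f (at y) (V y)) has_derivative
      (\<lambda>k. frechet_derivative W (at (f x)) (frechet_derivative f (at x) k))) (at x)"
    by (rule has_derivative_transform_within_open[OF _ S]) (simp add: rel)
  from has_derivative_unique[OF 1 this] show ?thesis by metis
qed

text \<open>In the difference of two instances of the previous lemma, the second derivatives of
  \<open>f\<close> cancel by symmetry.\<close>

lemma related_fields_bracket:
  fixes f :: "'e::real_inner \<Rightarrow> 'f::real_inner"
  assumes fd: "finite_dim TYPE('e)" and S: "open S" "x \<in> S" and f: "C_k_on (Suc (Suc 0)) f S"
    and V: "V differentiable (at x)" "V' differentiable (at x)"
    and W: "W differentiable (at (f x))" "W' differentiable (at (f x))"
    and rel: "\<And>y. y \<in> S \<Longrightarrow> frechet_derivative f (at y) (V y) = W (f y)"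
      "\<And>y. y \<in> S \<Longrightarrow> frechet_derivative f (at y) (V' y) = W' (f y)"
  shows "frechet_derivative f (at x) (frechet_derivative V' (at x) (V x) - frechet_derivative V (at x) (V' x))
    = frechet_derivative W' (at (f x)) (W (f x)) - frechet_derivative W (at (f x)) (W' (f x))"
proof -
  have "linear (frechet_derivative f (at x))" using f S by (intro linear_frechet_derivative) simp
  then have "frechet_derivative f (at x) (frechet_derivative V' (at x) (V x) - frechet_derivative V (at x) (V' x))
    = (frechet_derivative (\<lambda>y. frechet_derivative f (at y) (V' x)) (at x) (V x)
        + frechet_derivative f (at x) (frechet_derivative V' (at x) (V x)))
      - (frechet_derivative (\<lambda>y. frechet_derivative f (at y) (V x)) (at x) (V' x)
        + frechet_derivative f (at x) (frechet_derivative V (at x) (V' x)))"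
    using frechet_derivative_symmetric[OF S f, of "V x" "V' x"] by (simp add: linear_diff)
  also have "\<dots> = frechet_derivative W' (at (f x)) (frechet_derivative f (at x) (V x))
      - frechet_derivative W (at (f x)) (frechet_derivative f (at x) (V' x))"
    by (intro arg_cong2[where f = "(-)"] related_fields_derivative[OF fd S f] V W rel)
  also have "\<dots> = frechet_derivative W' (at (f x)) (W (f x)) - frechet_derivative W (at (f x)) (W' (f x))"
    using rel S(2) by simp
  finally show ?thesis .
qed

text \<open>The Koszul formula: constancy of the products \<open>c\<close> and \<open>d\<close> removes all derivatives of
  inner products, and only the bracket term remains.\<close>

lemma koszul_constant_products:
  fixes m :: "'e::real_inner \<Rightarrow> 'e \<Rightarrow> 'e \<Rightarrow> real"
  assumes fd: "finite_dim TYPE('e)" and S: "open S" "x \<in> S" and m: "\<And>y. y \<in> S \<Longrightarrow> inner_form (m y)"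
    and dm: "\<And>v w. (\<lambda>y. m y v w) differentiable (at x)"
    and V: "V differentiable (at x)" and Z: "Z differentiable (at x)"
    and const: "\<And>y. y \<in> S \<Longrightarrow> m y (V y) (V y) = c" "\<And>y. y \<in> S \<Longrightarrow> m y (V y) (Z y) = d"
    and \<Gamma>: "\<And>u. 2 * m x \<Gamma> u = frechet_derivative (\<lambda>y. m y (V x) u) (at x) (V x)
       + frechet_derivative (\<lambda>y. m y (V x) u) (at x) (V x)
       - frechet_derivative (\<lambda>y. m y (V x) (V x)) (at x) u"
  shows "m x (frechet_derivative V (at x) (V x) + \<Gamma>) (Z x) =
    m x (V x) (frechet_derivative V (at x) (Z x) - frechet_derivative Z (at x) (V x))"
proof -
  \<comment> \<open>Differentiating a constant product gives zero. The case \<open>Y = V\<close> is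
    needed in direction \<open>Z x\<close>, the case \<open>Y = Z\<close> in direction
    \<open>V x\<close>.\<close>
  have *: "frechet_derivative (\<lambda>y. m y (V x) (Y x)) (at x) k
      + m x (frechet_derivative V (at x) k) (Y x) + m x (V x) (frechet_derivative Y (at x) k) = 0"
    if Y: "Y differentiable (at x)" and "\<And>y. y \<in> S \<Longrightarrow> m y (V y) (Y y) = c" for Y c k
  proof -
    have 1: "((\<lambda>y. m y (V y) (Y y)) has_derivative (\<lambda>k. 0)) (at x)"
      by (rule has_derivative_transform_within_open[OF has_derivative_const[of c] S]) (simp add: that)
    have 2: "((\<lambda>y. m y (V y) (Y y)) has_derivative
      (\<lambda>k. frechet_derivative (\<lambda>y. m y (V x) (Y x)) (at x) k
        + m x (frechet_derivative V (at x) k) (Y x) + m x (V x) (frechet_derivative Y (at x) k))) (at x)"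
      by (rule has_derivative_bilinear_family[where \<beta> = m, OF fd S _ _ V Y])
        (use inner_form_bilinear[OF m] dm in auto)
    from fun_cong[OF has_derivative_unique[OF 2 1], of k] show ?thesis .
  qed
  note mx = m[OF S(2)]
  have "frechet_derivative (\<lambda>y. m y (V x) (V x)) (at x) (Z x)
      + m x (frechet_derivative V (at x) (Z x)) (V x) + m x (V x) (frechet_derivative V (at x) (Z x)) = 0"
    by (rule *[of V c, OF V const(1)])
  moreover have "frechet_derivative (\<lambda>y. m y (V x) (Z x)) (at x) (V x)
      + m x (frechet_derivative V (at x) (V x)) (Z x) + m x (V x) (frechet_derivative Z (at x) (V x)) = 0"
    by (rule *[of Z d, OF Z const(2)])
  moreover have "m x (frechet_derivative V (at x) (Z x)) (V x) = m x (V x) (frechet_derivative V (at x) (Z x))"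
    by (rule inner_form_commute[OF mx])
  \<comment> \<open>The two vanishing sums eliminate the metric derivatives from
    \<open>\<Gamma>\<close> tested against \<open>Z x\<close>. By symmetry of \<open>m x\<close> the
    derivative of \<open>V\<close> along \<open>Z x\<close> occurs twice, which matches the factor
    2.\<close>
  ultimately show ?thesis
    unfolding inner_form_simps(2,3)[OF mx] using \<Gamma>[of "Z x"] by linarith
qed

section \<open>Derivatives, brackets and connections in charts\<close>

text \<open>Arbitrary charts are allowed here; \<open>differential\<close> is the instance with the
  chosen ones, and \<open>\<phi> = id\<close> gives the coordinate changes.\<close>

definition chart_derivative ::
    "('a, 'e::real_inner) chart \<Rightarrow> ('b, 'f::real_inner) chart \<Rightarrow> ('a \<Rightarrow> 'b) \<Rightarrow> 'a \<Rightarrow> 'e \<Rightarrow> 'f" where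
  "chart_derivative C D \<phi> p = frechet_derivative (local_rep C D \<phi>) (at (snd C p))"

lemma is_chartD:
  assumes "is_chart C"
  shows "open (fst C)" "open (snd C ` fst C)" "homeomorphism (fst C) (snd C ` fst C) (snd C) (chart_inv C)"
    "p \<in> fst C \<Longrightarrow> chart_inv C (snd C p) = p" "inj_on (snd C) (fst C)"
proof -
  show h: "open (fst C)" "open (snd C ` fst C)" "homeomorphism (fst C) (snd C ` fst C) (snd C) (chart_inv C)"
    using assms unfolding is_chart_def by auto
  show i: "p \<in> fst C \<Longrightarrow> chart_inv C (snd C p) = p" for p using h(3) by (simp add: homeomorphism_def)
  show "inj_on (snd C) (fst C)" by (rule inj_on_inverseI) (rule i)
qed

lemma open_chart_image:
  assumes "is_chart C" "open U" "U \<subseteq> fst C"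
  shows "open (snd C ` U)"
proof -
  have "openin (top_of_set (fst C)) U" using assms(2,3) by (simp add: open_subset)
  then have "openin (top_of_set (snd C ` fst C)) (snd C ` U)"
    by (rule homeomorphism_imp_open_map[OF is_chartD(3)[OF assms(1)]])
  then show ?thesis using is_chartD(2)[OF assms(1)] by (simp add: openin_open_eq)
qed

text \<open>The inverse of the product map, taken by \<open>inv_into\<close>, agrees with the
  product of the inverses only on the image; continuity is transferred from there.\<close>

lemma is_chart_prod:
  assumes C: "is_chart C" and D: "is_chart D"
  shows "is_chart (fst C \<times> fst D, map_prod (snd C) (snd D))"
proof -
  let ?g = "inv_into (fst C \<times> fst D) (map_prod (snd C) (snd D))"
  have inj: "inj_on (map_prod (snd C) (snd D)) (fst C \<times> fst D)"
    using is_chartD(5)[OF C] is_chartD(5)[OF D] by (rule map_prod_inj_on)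
  have im: "map_prod (snd C) (snd D) ` (fst C \<times> fst D) = (snd C ` fst C) \<times> (snd D ` fst D)"
    by (auto simp: map_prod_def)
  have g: "?g z = (chart_inv C (fst z), chart_inv D (snd z))"
    if "z \<in> (snd C ` fst C) \<times> (snd D ` fst D)" for z
    using that by (auto intro!: inv_into_f_eq[OF inj] simp: is_chartD(4)[OF C] is_chartD(4)[OF D])
  have cont: "continuous_on (fst C) (snd C)" "continuous_on (fst D) (snd D)"
    "continuous_on (snd C ` fst C) (chart_inv C)" "continuous_on (snd D ` fst D) (chart_inv D)"
    using is_chartD(3)[OF C] is_chartD(3)[OF D] by (auto simp: homeomorphism_def)
  have "continuous_on ((snd C ` fst C) \<times> (snd D ` fst D)) (\<lambda>z. (chart_inv C (fst z), chart_inv D (snd z)))"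
    by (intro continuous_on_Pair continuous_on_compose2[OF cont(3)] continuous_on_compose2[OF cont(4)]
        continuous_on_fst continuous_on_snd continuous_on_id) auto
  then have "continuous_on ((snd C ` fst C) \<times> (snd D ` fst D)) ?g"
    using g by (simp cong: continuous_on_cong)
  moreover have "continuous_on (fst C \<times> fst D) (map_prod (snd C) (snd D))"
    unfolding map_prod_def case_prod_beta
    by (intro continuous_on_Pair continuous_on_compose2[OF cont(1)] continuous_on_compose2[OF cont(2)]
        continuous_on_fst continuous_on_snd continuous_on_id) auto
  moreover have "?g (map_prod (snd C) (snd D) x) = x" if "x \<in> fst C \<times> fst D" for x
    by (rule inv_into_f_f[OF inj that])
  moreover have "map_prod (snd C) (snd D) (?g y) = y" if "y \<in> (snd C ` fst C) \<times> (snd D ` fst D)" for y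
    using that by (intro f_inv_into_f) (simp add: im)
  moreover have "?g ` ((snd C ` fst C) \<times> (snd D ` fst D)) = fst C \<times> fst D"
    unfolding im[symmetric] by (rule inv_into_image_cancel[OF inj]) simp
  ultimately show ?thesis
    using is_chartD(1,2)[OF C] is_chartD(1,2)[OF D]
    unfolding is_chart_def fst_conv snd_conv im homeomorphism_def by (auto intro: open_Times simp: im)
qed

section \<open>Derivatives of smooth maps and coordinate changes\<close>

lemma smooth_atlas_is_chart: "smooth_atlas A \<Longrightarrow> C \<in> A \<Longrightarrow> is_chart C"
  unfolding smooth_atlas_def by blast

lemma smooth_atlas_finite_dim: "smooth_atlas (A :: ('a::{t2_space,second_countable_topology}, 'e::real_inner) chart set) \<Longrightarrow> finite_dim TYPE('e)"
  unfolding smooth_atlas_def finite_dim_def by blast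

lemma chart_at_mem:
  assumes "smooth_atlas A"
  shows "chart_at A p \<in> A" "p \<in> fst (chart_at A p)"
proof -
  have "\<exists>C. C \<in> A \<and> p \<in> fst C" using assms unfolding smooth_atlas_def by blast
  then show "chart_at A p \<in> A" "p \<in> fst (chart_at A p)"
    unfolding chart_at_def by (metis (mono_tags, lifting) someI_ex)+
qed

lemma smooth_map_id: "smooth_atlas A \<Longrightarrow> smooth_map A A id"
  unfolding smooth_map_def smooth_atlas_def by (auto intro: continuous_intros)

lemma smooth_map_local_rep:
  assumes "smooth_map A B \<phi>" "C \<in> A" "D \<in> B"
  shows "C_k_on k (local_rep C D \<phi>) (snd C ` (fst C \<inter> \<phi> -` fst D))"
  using assms unfolding smooth_map_def smooth_on_def by blast

lemma open_smooth_map_domain: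
  assumes "smooth_map A B \<phi>" "is_chart C" "is_chart D"
  shows "open (snd C ` (fst C \<inter> \<phi> -` fst D))"
proof (rule open_chart_image[OF assms(2)])
  have "continuous_on UNIV \<phi>" using assms(1) unfolding smooth_map_def by blast
  then show "open (fst C \<inter> \<phi> -` fst D)"
    using is_chartD(1)[OF assms(2)] is_chartD(1)[OF assms(3)] by (simp add: open_Int open_vimage)
qed simp

lemma local_rep_has_derivative:
  assumes "smooth_map A B \<phi>" "C \<in> A" "D \<in> B" "p \<in> fst C" "\<phi> p \<in> fst D"
  shows "(local_rep C D \<phi> has_derivative chart_derivative C D \<phi> p) (at (snd C p))"
proof -
  have "snd C p \<in> snd C ` (fst C \<inter> \<phi> -` fst D)" using assms(4,5) by blast
  then show ?thesis
    using smooth_map_local_rep[OF assms(1-3), of "Suc 0"]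
    unfolding chart_derivative_def frechet_derivative_works[symmetric] by auto
qed

lemma linear_chart_derivative:
  assumes "smooth_map A B \<phi>" "C \<in> A" "D \<in> B" "p \<in> fst C" "\<phi> p \<in> fst D"
  shows "linear (chart_derivative C D \<phi> p)"
  using local_rep_has_derivative[OF assms] by (rule has_derivative_linear)

text \<open>The local representations compose only where \<open>\<phi>\<close> lands in
  \<open>D\<close>; this set is open, so the chain rule still applies. With identities as factors it
  also covers changes of chart.\<close>

lemma chart_derivative_compose:
  assumes "smooth_atlas A" "smooth_atlas B" and \<phi>: "smooth_map A B \<phi>" and \<psi>: "smooth_map B E \<psi>"
    and C: "C \<in> A" "p \<in> fst C" and D: "D \<in> B" "\<phi> p \<in> fst D" and F: "F \<in> E" "\<psi> (\<phi> p) \<in> fst F"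
  shows "chart_derivative C F (\<psi> \<circ> \<phi>) p = chart_derivative D F \<psi> (\<phi> p) \<circ> chart_derivative C D \<phi> p"
proof -
  have c: "is_chart C" "is_chart D" using assms smooth_atlas_is_chart by blast+
  note inv = is_chartD(4)[OF c(1)] is_chartD(4)[OF c(2)]
  have x: "snd D (\<phi> p) = local_rep C D \<phi> (snd C p)" using C by (simp add: inv)
  have "(local_rep D F \<psi> \<circ> local_rep C D \<phi> has_derivative
      chart_derivative D F \<psi> (\<phi> p) \<circ> chart_derivative C D \<phi> p) (at (snd C p))"
    using local_rep_has_derivative[OF \<phi> C(1) D(1) C(2) D(2)]
      local_rep_has_derivative[OF \<psi> D(1) F(1) D(2) F(2)]
    unfolding x by (rule diff_chain_at)
  moreover have "open (snd C ` (fst C \<inter> \<phi> -` fst D))" by (rule open_smooth_map_domain[OF \<phi> c])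
  moreover have "snd C p \<in> snd C ` (fst C \<inter> \<phi> -` fst D)" using C D by blast
  ultimately have "(local_rep C F (\<psi> \<circ> \<phi>) has_derivative
      chart_derivative D F \<psi> (\<phi> p) \<circ> chart_derivative C D \<phi> p) (at (snd C p))"
    by (rule has_derivative_transform_within_open) (auto simp: inv)
  then show ?thesis unfolding chart_derivative_def[of C F] by (rule frechet_derivativeI)
qed

lemma chart_derivative_id:
  assumes A: "smooth_atlas A" and C: "C \<in> A" "p \<in> fst C"
  shows "chart_derivative C C id p = id"
proof -
  note c = smooth_atlas_is_chart[OF A C(1)]
  have "(id has_derivative id) (at (snd C p))" by (simp add: has_derivative_ident id_def)
  moreover have "snd C p \<in> snd C ` fst C" using C by blast
  ultimately have "(local_rep C C id has_derivative id) (at (snd C p))"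
    by (rule has_derivative_transform_within_open[OF _ is_chartD(2)[OF c]]) (auto simp: is_chartD(4)[OF c])
  then show ?thesis unfolding chart_derivative_def by (rule frechet_derivativeI)
qed

lemma chart_derivative_inverse:
  assumes A: "smooth_atlas A" and C: "C \<in> A" "p \<in> fst C" and D: "D \<in> A" "p \<in> fst D"
  shows "chart_derivative D C id p (chart_derivative C D id p v) = v"
  using chart_derivative_compose[OF A A smooth_map_id[OF A] smooth_map_id[OF A] C, of D C] C D
  by (simp add: chart_derivative_id[OF A C] fun_eq_iff)

lemma differential_eq_chart_derivative:
  "differential A B \<phi> p = chart_derivative (chart_at A p) (chart_at B (\<phi> p)) \<phi> p"
  unfolding differential_def chart_derivative_def coord_at_def ..

lemma differential_compose:
  assumes A: "smooth_atlas A" and B: "smooth_atlas B" and E: "smooth_atlas E"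
    and \<phi>: "smooth_map A B \<phi>" and \<psi>: "smooth_map B E \<psi>"
  shows "differential A E (\<lambda>x. \<psi> (\<phi> x)) p v = differential B E \<psi> (\<phi> p) (differential A B \<phi> p v)"
  using chart_derivative_compose[OF A B \<phi> \<psi>, of "chart_at A p" p "chart_at B (\<phi> p)" "chart_at E (\<psi> (\<phi> p))"]
    chart_at_mem[OF A] chart_at_mem[OF B] chart_at_mem[OF E]
  by (simp add: differential_eq_chart_derivative comp_def)

lemma differential_id: "smooth_atlas A \<Longrightarrow> differential A A (\<lambda>x. x) p v = v"
  using chart_derivative_id[of A "chart_at A p" p] chart_at_mem[of A p]
  by (simp add: differential_eq_chart_derivative id_def)

lemma linear_differential:
  assumes "smooth_atlas A" "smooth_atlas B" "smooth_map A B \<phi>"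
  shows "linear (differential A B \<phi> p)"
  unfolding differential_eq_chart_derivative
  by (intro linear_chart_derivative[OF assms(3)] chart_at_mem assms)

section \<open>Fields and metrics in charts\<close>

lemma field_in_chart_eq:
  assumes "smooth_atlas A" "C \<in> A" "p \<in> fst C"
  shows "field_in_chart A X C (snd C p) = chart_derivative (chart_at A p) C id p (X p)"
  using is_chartD(4)[OF smooth_atlas_is_chart[OF assms(1,2)] assms(3)]
  unfolding field_in_chart_def Let_def coord_at_def chart_derivative_def by simp

lemma field_in_own_chart:
  assumes "smooth_atlas A"
  shows "field_in_chart A X (chart_at A p) (coord_at A p) = X p"
  unfolding coord_at_def
  by (simp add: field_in_chart_eq[OF assms] chart_derivative_id[OF assms] chart_at_mem[OF assms])

lemma metric_in_chart_eq:
  assumes "smooth_atlas A" "C \<in> A" "p \<in> fst C"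
  shows "metric_in_chart A g C (snd C p) v w =
    g p (chart_derivative C (chart_at A p) id p v) (chart_derivative C (chart_at A p) id p w)"
  using is_chartD(4)[OF smooth_atlas_is_chart[OF assms(1,2)] assms(3)]
  unfolding metric_in_chart_def Let_def chart_derivative_def by simp

lemma metric_in_own_chart:
  assumes "smooth_atlas A"
  shows "metric_in_chart A g (chart_at A p) (coord_at A p) = g p"
  unfolding coord_at_def
  by (simp add: fun_eq_iff metric_in_chart_eq[OF assms] chart_derivative_id[OF assms] chart_at_mem[OF assms])

lemma metric_in_chart_fields:
  assumes A: "smooth_atlas A" and C: "C \<in> A" "p \<in> fst C"
  shows "metric_in_chart A g C (snd C p) (field_in_chart A X C (snd C p)) (field_in_chart A Y C (snd C p))
    = g p (X p) (Y p)"
  by (simp add: metric_in_chart_eq[OF A C] field_in_chart_eq[OF A C] chart_derivative_inverse[OF A _ _ C]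
      chart_at_mem[OF A])

lemma riemannian_metric_inner_form: "riemannian_metric A g \<Longrightarrow> inner_form (g p)"
  unfolding riemannian_metric_def inner_form_def by blast

lemma inner_form_metric_in_chart:
  assumes A: "smooth_atlas A" and g: "riemannian_metric A g" and C: "C \<in> A" "p \<in> fst C"
  shows "inner_form (metric_in_chart A g C (snd C p))"
proof -
  let ?T = "chart_derivative C (chart_at A p) id p"
  note b = riemannian_metric_inner_form[OF g, of p]
  have T: "linear ?T"
    by (rule linear_chart_derivative[OF smooth_map_id[OF A]]) (use C chart_at_mem[OF A] in auto)
  \<comment> \<open>The coordinate change back to \<open>C\<close> is linear and undoes
    \<open>?T\<close>, so \<open>?T\<close> is injective.\<close>
  have "?T v \<noteq> 0" if "v \<noteq> 0" for v
    using chart_derivative_inverse[OF A C chart_at_mem[OF A], of v] that linear_0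
      linear_chart_derivative[OF smooth_map_id[OF A] chart_at_mem(1)[OF A] C(1) chart_at_mem(2)[OF A], of p] C(2)
    by (metis id_apply)
  then show ?thesis
    unfolding inner_form_def bilinear_def metric_in_chart_eq[OF A C]
    using inner_form_pos[OF b] inner_form_commute[OF b]
      linear_compose[OF T inner_form_linear(1)[OF b]] linear_compose[OF T inner_form_linear(2)[OF b]]
    by (auto simp: comp_def)
qed

lemma metric_in_chart_differentiable:
  assumes "riemannian_metric A g" "C \<in> A" "y \<in> snd C ` fst C"
  shows "(\<lambda>y. metric_in_chart A g C y v w) differentiable (at y)"
proof -
  have "C_k_on (Suc 0) (\<lambda>y. metric_in_chart A g C y v w) (snd C ` fst C)"
    using assms unfolding riemannian_metric_def smooth_on_def by blast
  then show ?thesis using assms(3) by auto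
qed

text \<open>The right-hand side is linear in \<open>u\<close>, so it is represented by exactly one
  vector with respect to \<open>m y\<close>.\<close>

lemma christoffel_eq:
  fixes A :: "('a::{t2_space,second_countable_topology}, 'e::real_inner) chart set"
  assumes A: "smooth_atlas A" and g: "riemannian_metric A g" and C: "C \<in> A" "y \<in> snd C ` fst C"
  defines "m \<equiv> metric_in_chart A g C"
  shows "2 * m y (christoffel A g C y v w) u =
         frechet_derivative (\<lambda>x. m x w u) (at y) v
       + frechet_derivative (\<lambda>x. m x v u) (at y) w
       - frechet_derivative (\<lambda>x. m x v w) (at y) u"
proof -
  define R where "R = (\<lambda>u. frechet_derivative (\<lambda>x. m x w u) (at y) v
       + frechet_derivative (\<lambda>x. m x v u) (at y) w
       - frechet_derivative (\<lambda>x. m x v w) (at y) u)"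
  note op = is_chartD(2)[OF smooth_atlas_is_chart[OF A C(1)]]
  have form: "inner_form (m x)" if "x \<in> snd C ` fst C" for x
    using that inner_form_metric_in_chart[OF A g C(1)] unfolding m_def by blast
  have d: "(\<lambda>x. m x v w) differentiable (at y)" for v w
    unfolding m_def by (rule metric_in_chart_differentiable[OF g C])
  have l1: "linear (\<lambda>u. frechet_derivative (\<lambda>x. m x w u) (at y) v)" for v w
    by (rule linear_frechet_derivative_family[OF op C(2), where L = "\<lambda>x. m x w"])
      (use inner_form_linear(1)[OF form] d in auto)
  have "linear R" unfolding R_def
    by (intro linear_compose_sub linear_compose_add l1 linear_frechet_derivative d)
  then have "linear (\<lambda>u. R u / 2)"
    using linear_compose_scale_right[of R "1/2"] by simp
  then have "\<exists>!z. \<forall>u. m y z u = R u / 2"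
    by (rule riesz_representation[OF smooth_atlas_finite_dim[OF A] form[OF C(2)]])
  then have "\<exists>!z. \<forall>u. 2 * m y z u = R u" by (simp add: eq_divide_eq mult.commute)
  from theI'[OF this] show ?thesis unfolding christoffel_def m_def[symmetric] Let_def R_def by blast
qed

text \<open>Both sides are the derivative of \<open>\<phi>\<close> from the chosen chart at
  \<open>p\<close> to \<open>D\<close>, factored once through \<open>C\<close> and once through the
  chosen chart at \<open>\<phi> p\<close>.\<close>

lemma field_in_chart_related:
  assumes A: "smooth_atlas A" and B: "smooth_atlas B" and \<phi>: "smooth_map A B \<phi>"
    and C: "C \<in> A" "p \<in> fst C" and D: "D \<in> B" "\<phi> p \<in> fst D"
    and rel: "differential A B \<phi> p (X p) = Y (\<phi> p)"
  shows "chart_derivative C D \<phi> p (field_in_chart A X C (snd C p)) = field_in_chart B Y D (snd D (\<phi> p))"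
proof -
  note at = chart_at_mem[OF A, of p] chart_at_mem[OF B, of "\<phi> p"]
  have "chart_derivative C D \<phi> p (field_in_chart A X C (snd C p)) = chart_derivative (chart_at A p) D (\<phi> \<circ> id) p (X p)"
    using chart_derivative_compose[OF A A smooth_map_id[OF A] \<phi>, of "chart_at A p" p C D] C D at
    by (simp add: field_in_chart_eq[OF A C])
  also have "\<dots> = chart_derivative (chart_at A p) D (id \<circ> \<phi>) p (X p)" by simp
  also have "\<dots> = chart_derivative (chart_at B (\<phi> p)) D id (\<phi> p) (differential A B \<phi> p (X p))"
    using chart_derivative_compose[OF A B \<phi> smooth_map_id[OF B], of "chart_at A p" p "chart_at B (\<phi> p)" D] D at
    by (simp add: differential_eq_chart_derivative)
  finally show ?thesis by (simp add: rel field_in_chart_eq[OF B D])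
qed

text \<open>Brackets and covariant derivatives at \<open>p\<close> differentiate once, in the chart
  chosen at \<open>p\<close>; no more is demanded.\<close>

definition differentiable_field :: "('a, 'e::real_inner) chart set \<Rightarrow> ('a \<Rightarrow> 'e) \<Rightarrow> bool" where
  "differentiable_field A X \<longleftrightarrow>
     (\<forall>p. field_in_chart A X (chart_at A p) differentiable (at (coord_at A p)))"

definition self_covariant_derivative ::
    "('a, 'e::real_inner) chart set \<Rightarrow> ('a \<Rightarrow> 'e \<Rightarrow> 'e \<Rightarrow> real) \<Rightarrow> ('a \<Rightarrow> 'e) \<Rightarrow> 'a \<Rightarrow> 'e" where
  "self_covariant_derivative A g X p =
     frechet_derivative (field_in_chart A X (chart_at A p)) (at (coord_at A p)) (X p)
     + christoffel A g (chart_at A p) (coord_at A p) (X p) (X p)"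


section \<open>Related fields in a fixed pair of charts\<close>

abbreviation own_rep ::
    "('a, 'e::real_inner) chart set \<Rightarrow> ('b, 'f::real_inner) chart set \<Rightarrow> ('a \<Rightarrow> 'b) \<Rightarrow> 'a \<Rightarrow> 'e \<Rightarrow> 'f" where
  "own_rep A B \<phi> p \<equiv> local_rep (chart_at A p) (chart_at B (\<phi> p)) \<phi>"

abbreviation own_domain ::
    "('a, 'e::real_inner) chart set \<Rightarrow> ('b, 'f::real_inner) chart set \<Rightarrow> ('a \<Rightarrow> 'b) \<Rightarrow> 'a \<Rightarrow> 'e set" where
  "own_domain A B \<phi> p \<equiv> snd (chart_at A p) ` (fst (chart_at A p) \<inter> \<phi> -` fst (chart_at B (\<phi> p)))"

lemma own_rep_coord_at:
  assumes "smooth_atlas A"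
  shows "own_rep A B \<phi> p (coord_at A p) = coord_at B (\<phi> p)"
  using is_chartD(4)[OF smooth_atlas_is_chart[OF assms chart_at_mem(1)[OF assms]] chart_at_mem(2)[OF assms]]
  unfolding coord_at_def by simp

context
  fixes A :: "('a::{t2_space,second_countable_topology}, 'e::real_inner) chart set"
    and B :: "('b::{t2_space,second_countable_topology}, 'f::real_inner) chart set"
    and \<phi> :: "'a \<Rightarrow> 'b"
  assumes A: "smooth_atlas A" and B: "smooth_atlas B" and \<phi>: "smooth_map A B \<phi>"
begin

lemma own_domain: "open (own_domain A B \<phi> p)" "coord_at A p \<in> own_domain A B \<phi> p"
proof -
  show "open (own_domain A B \<phi> p)"
    by (intro open_smooth_map_domain[OF \<phi>] smooth_atlas_is_chart[OF A] smooth_atlas_is_chart[OF B]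
        chart_at_mem(1) A B)
  show "coord_at A p \<in> own_domain A B \<phi> p"
    using chart_at_mem(2)[OF A] chart_at_mem(2)[OF B] unfolding coord_at_def by blast
qed

lemma C_k_on_own_rep: "C_k_on k (own_rep A B \<phi> p) (own_domain A B \<phi> p)"
  by (intro smooth_map_local_rep[OF \<phi>] chart_at_mem A B)

lemma frechet_derivative_own_rep:
  "frechet_derivative (own_rep A B \<phi> p) (at (coord_at A p)) = differential A B \<phi> p"
  unfolding differential_def ..

text \<open>A relation at every \<open>q\<close> becomes one on an open set in charts that no longer
  vary with \<open>q\<close>, ready to be differentiated.\<close>

lemma own_rep_related:
  assumes rel: "\<And>q. differential A B \<phi> q (X q) = Y (\<phi> q)" and y: "y \<in> own_domain A B \<phi> p"
  shows "frechet_derivative (own_rep A B \<phi> p) (at y) (field_in_chart A X (chart_at A p) y)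
    = field_in_chart B Y (chart_at B (\<phi> p)) (own_rep A B \<phi> p y)"
proof -
  obtain q where q: "q \<in> fst (chart_at A p)" "\<phi> q \<in> fst (chart_at B (\<phi> p))" "y = snd (chart_at A p) q"
    using y by blast
  have "own_rep A B \<phi> p y = snd (chart_at B (\<phi> p)) (\<phi> q)"
    using is_chartD(4)[OF smooth_atlas_is_chart[OF A chart_at_mem(1)[OF A]] q(1)] unfolding q(3) by simp
  then show ?thesis
    using field_in_chart_related[where X = X and Y = Y, OF A B \<phi> chart_at_mem(1)[OF A] q(1)
        chart_at_mem(1)[OF B] q(2) rel]
    unfolding q(3) chart_derivative_def by simp
qed

lemma lie_bracket_related:
  assumes d: "differentiable_field A X" "differentiable_field A X'" "differentiable_field B Y" "differentiable_field B Y'"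
    and rel: "\<And>q. differential A B \<phi> q (X q) = Y (\<phi> q)" "\<And>q. differential A B \<phi> q (X' q) = Y' (\<phi> q)"
  shows "lie_bracket B Y Y' (\<phi> p) = differential A B \<phi> p (lie_bracket A X X' p)"
proof -
  have "frechet_derivative (own_rep A B \<phi> p) (at (coord_at A p))
      (frechet_derivative (field_in_chart A X' (chart_at A p)) (at (coord_at A p)) (field_in_chart A X (chart_at A p) (coord_at A p))
      - frechet_derivative (field_in_chart A X (chart_at A p)) (at (coord_at A p)) (field_in_chart A X' (chart_at A p) (coord_at A p)))
    = frechet_derivative (field_in_chart B Y' (chart_at B (\<phi> p))) (at (own_rep A B \<phi> p (coord_at A p)))
        (field_in_chart B Y (chart_at B (\<phi> p)) (own_rep A B \<phi> p (coord_at A p)))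
      - frechet_derivative (field_in_chart B Y (chart_at B (\<phi> p))) (at (own_rep A B \<phi> p (coord_at A p)))
        (field_in_chart B Y' (chart_at B (\<phi> p)) (own_rep A B \<phi> p (coord_at A p)))"
    by (rule related_fields_bracket[OF smooth_atlas_finite_dim[OF A] own_domain C_k_on_own_rep])
      (use d own_rep_related[of X Y, OF rel(1)] own_rep_related[of X' Y', OF rel(2)] in
        \<open>auto simp: differentiable_field_def own_rep_coord_at[OF A, unfolded comp_def]\<close>)
  then show ?thesis
    unfolding lie_bracket_def Let_def frechet_derivative_own_rep own_rep_coord_at[OF A] by (rule sym)
qed

text \<open>Differentiating the relation rewrites the second derivative of \<open>\<phi>\<close> as
  the derivative of \<open>Y\<close> along \<open>Y\<close> minus the image of that of
  \<open>X\<close> along \<open>X\<close>; the Christoffel terms complete both to covariant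
  derivatives.\<close>

lemma second_fundamental_form_related:
  assumes d: "differentiable_field A X" "differentiable_field B Y"
    and rel: "\<And>q. differential A B \<phi> q (X q) = Y (\<phi> q)"
  shows "second_fundamental_form A g B h \<phi> p (X p) (X p) =
    self_covariant_derivative B h Y (\<phi> p) - differential A B \<phi> p (self_covariant_derivative A g X p)"
proof -
  have "frechet_derivative (\<lambda>y. frechet_derivative (own_rep A B \<phi> p) (at y)
        (field_in_chart A X (chart_at A p) (coord_at A p))) (at (coord_at A p)) (X p)
      + frechet_derivative (own_rep A B \<phi> p) (at (coord_at A p))
        (frechet_derivative (field_in_chart A X (chart_at A p)) (at (coord_at A p)) (X p))
    = frechet_derivative (field_in_chart B Y (chart_at B (\<phi> p))) (at (own_rep A B \<phi> p (coord_at A p)))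
        (frechet_derivative (own_rep A B \<phi> p) (at (coord_at A p)) (X p))"
    by (rule related_fields_derivative[OF smooth_atlas_finite_dim[OF A] own_domain C_k_on_own_rep])
      (use d own_rep_related[of X Y, OF rel] in
        \<open>auto simp: differentiable_field_def own_rep_coord_at[OF A, unfolded comp_def]\<close>)
  then have "frechet_derivative (\<lambda>y. frechet_derivative (own_rep A B \<phi> p) (at y) (X p)) (at (coord_at A p)) (X p)
      + differential A B \<phi> p (frechet_derivative (field_in_chart A X (chart_at A p)) (at (coord_at A p)) (X p))
    = frechet_derivative (field_in_chart B Y (chart_at B (\<phi> p))) (at (coord_at B (\<phi> p))) (Y (\<phi> p))"
    unfolding field_in_own_chart[OF A] frechet_derivative_own_rep own_rep_coord_at[OF A] rel .
  then show ?thesis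
    unfolding second_fundamental_form_def self_covariant_derivative_def Let_def frechet_derivative_own_rep rel
    by (simp add: linear_add[OF linear_differential[OF A B \<phi>]] algebra_simps)
qed

end

lemma koszul_constant_fields:
  assumes A: "smooth_atlas A" and g: "riemannian_metric A g"
    and d: "differentiable_field A X" "differentiable_field A Z"
    and const: "\<And>p. g p (X p) (X p) = c" "\<And>p. g p (X p) (Z p) = c'"
  shows "g p (self_covariant_derivative A g X p) (Z p) = g p (X p) (lie_bracket A Z X p)"
proof -
  let ?C = "chart_at A p" and ?x = "coord_at A p"
  let ?m = "metric_in_chart A g ?C" and ?V = "field_in_chart A X ?C" and ?Z = "field_in_chart A Z ?C"
  note C = chart_at_mem[OF A, of p]
  have x: "?x \<in> snd ?C ` fst ?C" using C unfolding coord_at_def by blast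
  have "?m ?x (frechet_derivative ?V (at ?x) (?V ?x) + christoffel A g ?C ?x (?V ?x) (?V ?x)) (?Z ?x) =
    ?m ?x (?V ?x) (frechet_derivative ?V (at ?x) (?Z ?x) - frechet_derivative ?Z (at ?x) (?V ?x))"
  proof (rule koszul_constant_products[OF smooth_atlas_finite_dim[OF A] is_chartD(2)[OF smooth_atlas_is_chart[OF A C(1)]] x])
    fix y assume y: "y \<in> snd ?C ` fst ?C"
    then show "inner_form (?m y)" using inner_form_metric_in_chart[OF A g C(1)] by blast
    show "?m y (?V y) (?V y) = c" "?m y (?V y) (?Z y) = c'"
      using y metric_in_chart_fields[OF A C(1)] const by auto
  next
    show "(\<lambda>y. ?m y v w) differentiable (at ?x)" for v w
      by (rule metric_in_chart_differentiable[OF g C(1) x])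
    show "?V differentiable (at ?x)" "?Z differentiable (at ?x)"
      using d unfolding differentiable_field_def by auto
    show "2 * ?m ?x (christoffel A g ?C ?x (?V ?x) (?V ?x)) u = frechet_derivative (\<lambda>y. ?m y (?V ?x) u) (at ?x) (?V ?x)
       + frechet_derivative (\<lambda>y. ?m y (?V ?x) u) (at ?x) (?V ?x)
       - frechet_derivative (\<lambda>y. ?m y (?V ?x) (?V ?x)) (at ?x) u" for u
      by (rule christoffel_eq[OF A g C(1) x])
  qed
  then show ?thesis
    unfolding self_covariant_derivative_def lie_bracket_def Let_def metric_in_own_chart[OF A] field_in_own_chart[OF A] .
qed

section \<open>Left invariant fields\<close>

context
  fixes G :: "'a::{t2_space, second_countable_topology} monoid" (structure)
    and A :: "('a, 'e::real_inner) chart set"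
  assumes G: "lie_group G A"
begin

lemma lie_group_atlas: "smooth_atlas A" and lie_group_group: "group G" and lie_group_carrier: "carrier G = UNIV"
  and lie_group_mult: "smooth_map (prod_atlas A A) A (\<lambda>(x, y). x \<otimes> y)"
  using G unfolding lie_group_def by auto

lemma lie_group_simps: "x \<otimes> \<one> = x" "\<one> \<otimes> x = x" "x \<otimes> (inv x \<otimes> y) = y" "inv x \<otimes> x = \<one>"
  using lie_group_group lie_group_carrier
  by (simp_all add: group.is_monoid group.l_inv group.r_inv monoid.r_one monoid.l_one flip: monoid.m_assoc)

lemma lie_group_assoc: "x \<otimes> y \<otimes> z = x \<otimes> (y \<otimes> z)"
  using lie_group_group lie_group_carrier by (simp add: group.is_monoid monoid.m_assoc)

section \<open>Multiplication and translations in charts\<close>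

abbreviation (input) mult_rep where
  "mult_rep C D F \<equiv> local_rep (fst C \<times> fst D, map_prod (snd C) (snd D)) F (\<lambda>(x, y). x \<otimes> y)"

abbreviation (input) mult_domain where
  "mult_domain C D F \<equiv> map_prod (snd C) (snd D) ` ((fst C \<times> fst D) \<inter> (\<lambda>(x, y). x \<otimes> y) -` fst F)"

lemma mult_rep_C_k:
  assumes "C \<in> A" "D \<in> A" "F \<in> A"
  shows "open (mult_domain C D F)" "C_k_on k (mult_rep C D F) (mult_domain C D F)"
proof -
  let ?P = "(fst C \<times> fst D, map_prod (snd C) (snd D))"
  have "?P \<in> prod_atlas A A" using assms unfolding prod_atlas_def by blast
  then show "C_k_on k (mult_rep C D F) (mult_domain C D F)"
    using smooth_map_local_rep[OF lie_group_mult _ assms(3), of ?P] by simp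
  show "open (mult_domain C D F)"
    using open_smooth_map_domain[OF lie_group_mult, of ?P F] is_chart_prod[of C D]
      smooth_atlas_is_chart[OF lie_group_atlas] assms by simp
qed

lemma mult_rep_eq:
  assumes "C \<in> A" "D \<in> A" "x \<in> fst C" "y \<in> fst D"
  shows "mult_rep C D F (snd C x, snd D y) = snd F (x \<otimes> y)"
proof -
  let ?P = "(fst C \<times> fst D, map_prod (snd C) (snd D))"
  have "is_chart ?P" using is_chart_prod smooth_atlas_is_chart[OF lie_group_atlas] assms(1,2) by blast
  from is_chartD(4)[OF this, of "(x, y)"] show ?thesis using assms by simp
qed

text \<open>A coordinate map is injective, so the slice at \<open>snd C x\<close> involves no first
  factor other than \<open>x\<close>.\<close>

lemma mult_domain_slice:
  assumes "C \<in> A" "D \<in> A" "x \<in> fst C"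
  shows "Pair (snd C x) -` mult_domain C D F = snd D ` (fst D \<inter> (\<lambda>y. x \<otimes> y) -` fst F)"
proof -
  have "a = x" if "a \<in> fst C" "snd C a = snd C x" for a
    using inj_onD[OF is_chartD(5)[OF smooth_atlas_is_chart[OF lie_group_atlas assms(1)]]] that assms(3)
    by blast
  then have iff: "(snd C x, t) \<in> mult_domain C D F \<longleftrightarrow> t \<in> snd D ` (fst D \<inter> (\<lambda>y. x \<otimes> y) -` fst F)" for t
    using assms(3) by (auto simp: image_iff Bex_def)
  show ?thesis by (rule Set.set_eqI) (simp only: vimage_eq iff)
qed

lemma left_translation_rep:
  assumes C: "C \<in> A" "x \<in> fst C" and D: "D \<in> A" "y \<in> fst D"
  shows "mult_rep C D F (snd C x, snd D y) = local_rep D F (\<lambda>y. x \<otimes> y) (snd D y)"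
  using mult_rep_eq[OF C(1) D(1) C(2) D(2)]
    is_chartD(4)[OF smooth_atlas_is_chart[OF lie_group_atlas D(1)] D(2)] by simp

lemma smooth_left_translation: "smooth_map A A (\<lambda>y. x \<otimes> y)"
  unfolding smooth_map_def smooth_on_def
proof (intro conjI ballI allI)
  have "continuous_on UNIV (\<lambda>(x, y). x \<otimes> y)" using lie_group_mult unfolding smooth_map_def by blast
  then have "continuous_on UNIV ((\<lambda>(x, y). x \<otimes> y) \<circ> Pair x)"
    by (intro continuous_on_compose continuous_on_subset[where s = UNIV and t = "range (Pair x)"])
      (auto intro: continuous_intros)
  then show "continuous_on UNIV (\<lambda>y. x \<otimes> y)" by (simp add: comp_def)
next
  fix D F k assume D: "D \<in> A" and F: "F \<in> A"
  let ?C = "chart_at A x"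
  note C = chart_at_mem[OF lie_group_atlas, of x]
  have "C_k_on k (\<lambda>t. mult_rep ?C D F (snd ?C x, t)) (Pair (snd ?C x) -` mult_domain ?C D F)"
    by (rule C_k_on_slice[OF mult_rep_C_k[OF C(1) D F]])
  moreover have "open (Pair (snd ?C x) -` mult_domain ?C D F)"
    by (intro open_vimage mult_rep_C_k[OF C(1) D F] continuous_intros)
  ultimately show "C_k_on k (local_rep D F (\<lambda>y. x \<otimes> y)) (snd D ` (fst D \<inter> (\<lambda>y. x \<otimes> y) -` fst F))"
    unfolding mult_domain_slice[OF C(1) D C(2)]
    by (rule C_k_on_cong[rotated 2]) (use left_translation_rep[OF C D] in auto)
qed

lemma left_translation_compose:
  "differential A A (\<lambda>y. x \<otimes> y) (z \<otimes> p) (differential A A (\<lambda>y. z \<otimes> y) p v) =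
    differential A A (\<lambda>y. x \<otimes> z \<otimes> y) p v"
  using differential_compose[OF lie_group_atlas lie_group_atlas lie_group_atlas smooth_left_translation
      smooth_left_translation, of x z p v]
  by (simp add: lie_group_assoc)

lemma left_invariant_field_related:
  "differential A A (\<lambda>y. x \<otimes> y) p (left_invariant_field G A u p) = left_invariant_field G A u (x \<otimes> p)"
  using left_translation_compose[of x p \<one> u] unfolding left_invariant_field_def by (simp add: lie_group_simps)

lemma linear_left_invariant_field: "linear (\<lambda>u. left_invariant_field G A u p)"
  unfolding left_invariant_field_def
  by (rule linear_differential[OF lie_group_atlas lie_group_atlas smooth_left_translation])

text \<open>The vector is carried back to the unit by the translation with
  \<open>inv p\<close>.\<close>

lemma left_invariant_field_surj: "\<exists>u. left_invariant_field G A u p = v"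
proof
  show "left_invariant_field G A (differential A A (\<lambda>y. inv p \<otimes> y) p v) p = v"
    using left_translation_compose[of p "inv p" p v] differential_id[OF lie_group_atlas]
    unfolding left_invariant_field_def by (simp add: lie_group_simps lie_group_assoc)
qed

text \<open>In the charts \<open>C\<close> at \<open>q\<close> and \<open>D\<close> at the unit, a left invariant field is a partial
  derivative of the multiplication, hence smooth in \<open>q\<close>.\<close>

lemma left_invariant_field_in_chart:
  assumes C: "C \<in> A" "q \<in> fst C"
  defines "D \<equiv> chart_at A \<one>"
  shows "field_in_chart A (left_invariant_field G A u) C (snd C q) =
    frechet_derivative (mult_rep C D C) (at (snd C q, snd D \<one>)) (0, u)"
proof -
  note D = chart_at_mem[OF lie_group_atlas, of \<one>, folded D_def]
  have "field_in_chart A (left_invariant_field G A u) C (snd C q) =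
      chart_derivative D C (id \<circ> (\<lambda>y. q \<otimes> y)) \<one> u"
    using chart_derivative_compose[OF lie_group_atlas lie_group_atlas smooth_left_translation
        smooth_map_id[OF lie_group_atlas] D, of "chart_at A q" q C] chart_at_mem[OF lie_group_atlas, of q] C
    by (simp add: field_in_chart_eq[OF lie_group_atlas C] left_invariant_field_def
        differential_eq_chart_derivative D_def lie_group_simps)
  also have "\<dots> = frechet_derivative (local_rep D C (\<lambda>y. q \<otimes> y)) (at (snd D \<one>)) u"
    by (simp add: chart_derivative_def)
  also have "\<dots> = frechet_derivative (mult_rep C D C) (at (snd C q, snd D \<one>)) (0, u)"
  proof -
    have mem: "snd D \<one> \<in> Pair (snd C q) -` mult_domain C D C"
      unfolding mult_domain_slice[OF C(1) D(1) C(2)] using C D by (auto simp: lie_group_simps)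
    have op: "open (Pair (snd C q) -` mult_domain C D C)"
      by (intro open_vimage mult_rep_C_k[OF C(1) D(1) C(1)] continuous_intros)
    have "mult_rep C D C differentiable (at (snd C q, snd D \<one>))"
      by (rule C_k_on_SucD(1)[OF mult_rep_C_k(2)[OF C(1) D(1) C(1)] vimageD[OF mem]])
    from has_derivative_slice[OF this]
    have "(local_rep D C (\<lambda>y. q \<otimes> y) has_derivative
        (\<lambda>v. frechet_derivative (mult_rep C D C) (at (snd C q, snd D \<one>)) (0, v))) (at (snd D \<one>))"
      by (rule has_derivative_transform_within_open[OF _ op mem])
        (use left_translation_rep[OF C D(1)] in \<open>auto simp: mult_domain_slice[OF C(1) D(1) C(2)]\<close>)
    from fun_cong[OF frechet_derivativeI[OF this], of u] show ?thesis .
  qed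
  finally show ?thesis .
qed

text \<open>The field is a derivative of the multiplication in its second factor, taken at the unit.
  One more derivative, in the first factor, exists by smoothness of the multiplication.\<close>

lemma left_invariant_field_in_chart_differentiable:
  assumes C: "C \<in> A" "q \<in> fst C"
  shows "field_in_chart A (left_invariant_field G A u) C differentiable (at (snd C q))"
proof -
  define D where "D = chart_at A \<one>"
  note D = chart_at_mem[OF lie_group_atlas, of \<one>, folded D_def]
  have mem: "(snd C q, snd D \<one>) \<in> mult_domain C D C"
    using mult_domain_slice[OF C(1) D(1) C(2), of C] C D by (auto simp: lie_group_simps)
  have "(\<lambda>z. frechet_derivative (mult_rep C D C) (at z) (0, u)) differentiable (at (snd C q, snd D \<one>))"
    by (rule C_k_on_SucD(1)[OF C_k_on_SucD(2)[OF mult_rep_C_k(2)[OF C(1) D(1) C(1)]] mem])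
  then obtain F' where "((\<lambda>z. frechet_derivative (mult_rep C D C) (at z) (0, u)) has_derivative F')
      (at (snd C q, snd D \<one>))" by (auto simp: differentiable_def)
  moreover have "((\<lambda>s. (s, snd D \<one>)) has_derivative (\<lambda>v. (v, 0))) (at (snd C q))"
    by (auto intro!: derivative_eq_intros)
  ultimately have "((\<lambda>s. frechet_derivative (mult_rep C D C) (at (s, snd D \<one>)) (0, u)) has_derivative
      (\<lambda>v. F' (v, 0))) (at (snd C q))"
    by (rule has_derivative_compose[rotated])
  then have "(\<lambda>s. frechet_derivative (mult_rep C D C) (at (s, snd D \<one>)) (0, u)) differentiable (at (snd C q))"
    unfolding differentiable_def by blast
  then show ?thesis
    by (rule differentiable_cong_open[rotated 3])
      (use C is_chartD(2)[OF smooth_atlas_is_chart[OF lie_group_atlas C(1)]]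
        left_invariant_field_in_chart[OF C(1)] in \<open>auto simp: D_def\<close>)
qed

lemma differentiable_left_invariant_field: "differentiable_field A (left_invariant_field G A u)"
  unfolding differentiable_field_def coord_at_def
  by (intro allI left_invariant_field_in_chart_differentiable chart_at_mem lie_group_atlas)

text \<open>Translation by \<open>p\<close> relates both fields to themselves, hence also their
  bracket; at the unit that bracket is \<open>lie_ad\<close>.\<close>

lemma lie_bracket_left_invariant:
  "lie_bracket A (left_invariant_field G A u) (left_invariant_field G A v) p =
    left_invariant_field G A (lie_ad G A u v) p"
  using lie_bracket_related[OF lie_group_atlas lie_group_atlas smooth_left_translation
      differentiable_left_invariant_field differentiable_left_invariant_field
      differentiable_left_invariant_field differentiable_left_invariant_field
      left_invariant_field_related left_invariant_field_related, of u v p \<one>]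
  unfolding lie_ad_def left_invariant_field_def[of G A _ p] by (simp add: lie_group_simps)

lemma lie_ad_self: "lie_ad G A u u = 0"
  unfolding lie_ad_def lie_bracket_def Let_def by simp

text \<open>In the chart at the unit, the coordinates of the field of \<open>v\<close> are linear in
  \<open>v\<close> at each point, and this passes to both terms of the bracket.\<close>

lemma linear_lie_ad: "linear (lie_ad G A u)"
proof -
  define C where "C = chart_at A \<one>"
  define y where "y = coord_at A \<one>"
  define F where "F = (\<lambda>z v. field_in_chart A (left_invariant_field G A v) C z)"
  note C = chart_at_mem[OF lie_group_atlas, of \<one>, folded C_def]
  have y: "y = snd C \<one>" "y \<in> snd C ` fst C" using C unfolding y_def coord_at_def C_def by auto
  have lin: "linear (F z)" if z: "z \<in> snd C ` fst C" for z
  proof -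
    obtain q where q: "q \<in> fst C" "z = snd C q" using z by blast
    have "linear (chart_derivative (chart_at A q) C id q)"
      by (rule linear_chart_derivative[OF smooth_map_id[OF lie_group_atlas]])
        (use q C chart_at_mem[OF lie_group_atlas] in auto)
    from linear_compose[OF linear_left_invariant_field this]
    show ?thesis unfolding F_def q(2) field_in_chart_eq[OF lie_group_atlas C(1) q(1)] by (simp add: comp_def)
  qed
  have d: "(\<lambda>z. F z v) differentiable (at y)" for v
    unfolding F_def y(1) by (rule left_invariant_field_in_chart_differentiable[OF C])
  have "linear (\<lambda>v. frechet_derivative (\<lambda>z. F z v) (at y) (F y u))"
    by (rule linear_frechet_derivative_family[OF is_chartD(2)[OF smooth_atlas_is_chart[OF lie_group_atlas C(1)]] y(2) lin d])
  moreover have "linear (\<lambda>v. frechet_derivative (\<lambda>z. F z u) (at y) (F y v))"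
    using linear_compose[OF lin[OF y(2)] linear_frechet_derivative[OF d]] by (simp add: comp_def)
  ultimately have "linear (\<lambda>v. frechet_derivative (\<lambda>z. F z v) (at y) (F y u)
      - frechet_derivative (\<lambda>z. F z u) (at y) (F y v))"
    by (rule linear_compose_sub)
  then show ?thesis
    unfolding lie_ad_def[abs_def] lie_bracket_def Let_def F_def C_def y_def .
qed

lemma left_invariant_metric_field:
  assumes "left_invariant_metric G A g"
  shows "g p (left_invariant_field G A u p) (left_invariant_field G A v p) = g \<one> u v"
  using assms unfolding left_invariant_metric_def left_invariant_field_def by (metis lie_group_simps(1))

end

lemma left_invariant_koszul:
  assumes G: "riemannian_lie_group G A g"
  shows "g p (self_covariant_derivative A g (left_invariant_field G A u) p) (left_invariant_field G A w p)
    = g \<one>\<^bsub>G\<^esub> u (lie_ad G A w u)"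
proof -
  have G': "lie_group G A" and m: "riemannian_metric A g" and l: "left_invariant_metric G A g"
    using G unfolding riemannian_lie_group_def by auto
  have "g p (self_covariant_derivative A g (left_invariant_field G A u) p) (left_invariant_field G A w p)
    = g p (left_invariant_field G A u p) (lie_bracket A (left_invariant_field G A w) (left_invariant_field G A u) p)"
    by (rule koszul_constant_fields[OF lie_group_atlas[OF G'] m
          differentiable_left_invariant_field[OF G'] differentiable_left_invariant_field[OF G']
          left_invariant_metric_field[OF G' l] left_invariant_metric_field[OF G' l]])
  then show ?thesis
    by (simp add: lie_bracket_left_invariant[OF G'] left_invariant_metric_field[OF G' l])
qed

section \<open>Homomorphisms of Lie groups\<close>

context
  fixes G :: "'a::{t2_space, second_countable_topology} monoid"
    and A :: "('a, 'e::real_inner) chart set"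
    and H :: "'b::{t2_space, second_countable_topology} monoid"
    and B :: "('b, 'f::real_inner) chart set"
    and \<phi> :: "'a \<Rightarrow> 'b"
  assumes G: "lie_group G A" and H: "lie_group H B" and hom: "\<phi> \<in> hom G H" and \<phi>: "smooth_map A B \<phi>"
begin

lemma lie_hom_one: "\<phi> \<one>\<^bsub>G\<^esub> = \<one>\<^bsub>H\<^esub>"
  using hom_one[OF hom] lie_group_group[OF G] lie_group_group[OF H] by blast

text \<open>The chain rule is applied to both sides of
  \<open>\<phi>(x y) = \<phi>(x) \<phi>(y)\<close>, as functions of \<open>y\<close> at the
  unit.\<close>

lemma lie_hom_left_invariant_field:
  "differential A B \<phi> x (left_invariant_field G A u x) =
    left_invariant_field H B (differential A B \<phi> \<one>\<^bsub>G\<^esub> u) (\<phi> x)"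
proof -
  note at = lie_group_atlas[OF G] lie_group_atlas[OF H]
  have "differential A B \<phi> x (left_invariant_field G A u x) =
      differential A B (\<lambda>y. \<phi> (x \<otimes>\<^bsub>G\<^esub> y)) \<one>\<^bsub>G\<^esub> u"
    using differential_compose[OF at(1) at(1) at(2) smooth_left_translation[OF G] \<phi>, of x "\<one>\<^bsub>G\<^esub>" u]
    unfolding left_invariant_field_def by (simp add: lie_group_simps[OF G])
  also have "(\<lambda>y. \<phi> (x \<otimes>\<^bsub>G\<^esub> y)) = (\<lambda>y. \<phi> x \<otimes>\<^bsub>H\<^esub> \<phi> y)"
    using hom lie_group_carrier[OF G] by (simp add: hom_def)
  also have "differential A B (\<lambda>y. \<phi> x \<otimes>\<^bsub>H\<^esub> \<phi> y) \<one>\<^bsub>G\<^esub> u =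
      left_invariant_field H B (differential A B \<phi> \<one>\<^bsub>G\<^esub> u) (\<phi> x)"
    using differential_compose[OF at(1) at(2) at(2) \<phi> smooth_left_translation[OF H], of "\<phi> x" "\<one>\<^bsub>G\<^esub>" u]
    unfolding left_invariant_field_def lie_hom_one .
  finally show ?thesis .
qed

lemma lie_hom_lie_ad:
  "lie_ad H B (differential A B \<phi> \<one>\<^bsub>G\<^esub> u) (differential A B \<phi> \<one>\<^bsub>G\<^esub> v) =
    differential A B \<phi> \<one>\<^bsub>G\<^esub> (lie_ad G A u v)"
  using lie_bracket_related[OF lie_group_atlas[OF G] lie_group_atlas[OF H] \<phi>
      differentiable_left_invariant_field[OF G] differentiable_left_invariant_field[OF G]
      differentiable_left_invariant_field[OF H] differentiable_left_invariant_field[OF H]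
      lie_hom_left_invariant_field lie_hom_left_invariant_field, of u v "\<one>\<^bsub>G\<^esub>"]
  unfolding lie_hom_one lie_ad_def .

end

section \<open>Harmonicity\<close>

theorem proposition2p10:
  fixes G :: "'a::{t2_space, second_countable_topology} monoid"
    and A :: "('a, 'e::real_inner) chart set"
    and g :: "'a \<Rightarrow> 'e \<Rightarrow> 'e \<Rightarrow> real"
    and H :: "'b::{t2_space, second_countable_topology} monoid"
    and B :: "('b, 'f::real_inner) chart set"
    and h :: "'b \<Rightarrow> 'f \<Rightarrow> 'f \<Rightarrow> real"
    and \<phi> :: "'a \<Rightarrow> 'b"
  assumes "riemannian_lie_group G A g"
    and "riemannian_lie_group H B h"
    and "\<phi> \<in> hom G H"
    and "riemannian_immersion A g B h \<phi>"
    and "unimodular G A"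
    and "unimodular H B"
    and "dim (UNIV :: 'f set) = dim (UNIV :: 'e set) + 1"
  shows "harmonic_map A g B h \<phi>"
proof -
  note G = assms(1) and H = assms(2) and hom = assms(3)
  have G': "lie_group G A" and g: "riemannian_metric A g" "left_invariant_metric G A g"
    and H': "lie_group H B" and h: "riemannian_metric B h" "left_invariant_metric H B h"
    using G H unfolding riemannian_lie_group_def by auto
  have \<phi>: "smooth_map A B \<phi>"
    and iso: "h (\<phi> p) (differential A B \<phi> p v) (differential A B \<phi> p w) = g p v w" for p v w
    using assms(4) unfolding riemannian_immersion_def by auto
  note atlas = lie_group_atlas[OF G'] lie_group_atlas[OF H']
  note finA = smooth_atlas_finite_dim[OF atlas(1)] and finB = smooth_atlas_finite_dim[OF atlas(2)]
  define \<xi> where "\<xi> = differential A B \<phi> \<one>\<^bsub>G\<^esub>"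
  define X where "X = left_invariant_field G A"
  define Y where "Y = left_invariant_field H B"
  define DX where "DX = (\<lambda>u. self_covariant_derivative A g (X u))"
  define DY where "DY = (\<lambda>u. self_covariant_derivative B h (Y u))"
  define gu where "gu = g \<one>\<^bsub>G\<^esub>"
  define hu where "hu = h \<one>\<^bsub>H\<^esub>"
  have form: "inner_form (g p)" "inner_form (h q)" "inner_form gu" "inner_form hu" for p q
    using riemannian_metric_inner_form[OF g(1)] riemannian_metric_inner_form[OF h(1)]
    unfolding gu_def hu_def by auto
  have iso1: "hu (\<xi> u) (\<xi> v) = gu u v" for u v
    using iso[of "\<one>\<^bsub>G\<^esub>"] unfolding \<xi>_def hu_def gu_def lie_hom_one[OF G' H' hom \<phi>] .
  have hX: "g p (X u p) (X v p) = gu u v" for p u v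
    unfolding X_def gu_def by (rule left_invariant_metric_field[OF G' g(2)])
  have hY: "h q (Y u q) (Y v q) = hu u v" for q u v
    unfolding Y_def hu_def by (rule left_invariant_metric_field[OF H' h(2)])
  have rel: "differential A B \<phi> p (X u p) = Y (\<xi> u) (\<phi> p)" for p u
    unfolding X_def Y_def \<xi>_def by (rule lie_hom_left_invariant_field[OF G' H' hom \<phi>])
  have ad: "lie_ad H B (\<xi> u) (\<xi> v) = \<xi> (lie_ad G A u v)" for u v
    unfolding \<xi>_def by (rule lie_hom_lie_ad[OF G' H' hom \<phi>])
  have kX: "g p (DX u p) (X w p) = gu u (lie_ad G A w u)" for p u w
    unfolding DX_def X_def gu_def by (rule left_invariant_koszul[OF G])
  have kY: "h q (DY u q) (Y w q) = hu u (lie_ad H B w u)" for q u w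
    unfolding DY_def Y_def hu_def by (rule left_invariant_koszul[OF H])
  have II: "second_fundamental_form A g B h \<phi> p (X u p) (X u p) =
      DY (\<xi> u) (\<phi> p) - differential A B \<phi> p (DX u p)" for p u
    unfolding DX_def DY_def
    by (rule second_fundamental_form_related[OF atlas \<phi>])
      (auto simp: rel, auto simp: X_def Y_def differentiable_left_invariant_field[OF G']
        differentiable_left_invariant_field[OF H'])
  have "tension_field A g B h \<phi> p = 0" for p
  proof -
    define T where "T = tension_field A g B h \<phi> p"
    obtain E where E: "finite E" "orthonormal_basis (g p) E"
      "T = (\<Sum>e\<in>E. second_fundamental_form A g B h \<phi> p e e)"
      using metric_trace_orthonormal[OF finA form(1)] unfolding T_def tension_field_def by metis
    have onE: "orthonormal_set (g p) E" and spanE: "span E = UNIV"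
      using E(2) unfolding orthonormal_basis_iff[OF form(1)] by auto
    \<comment> \<open>The basis \<open>E\<close> lives at \<open>p\<close> and the brackets at the
      unit: \<open>\<epsilon>\<close> moves a vector back to the unit of \<open>G\<close>, and
      \<open>\<omega>\<close> sends it on to the Lie algebra of \<open>H\<close>.\<close>
    have "\<exists>u. X u p = e" for e
      unfolding X_def by (rule left_invariant_field_surj[OF G'])
    then obtain \<epsilon> where \<epsilon>: "X (\<epsilon> e) p = e" for e by metis
    define \<omega> where "\<omega> = (\<lambda>e. \<xi> (\<epsilon> e))"
    have on: "hu (\<omega> e) (\<omega> e') = (if e = e' then 1 else 0)" if "e \<in> E" "e' \<in> E" for e e'
      using onE that hX[of p "\<epsilon> e" "\<epsilon> e'"] unfolding \<omega>_def iso1 \<epsilon> orthonormal_set_def by simp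
    \<comment> \<open>Distinct basis vectors with the same image would have a product that is both 0
      and 1.\<close>
    have inj: "inj_on \<omega> E"
      by (rule inj_onI) (use on in \<open>metis zero_neq_one\<close>)
    have on': "orthonormal_set hu (\<omega> ` E)"
      unfolding orthonormal_set_def using on inj_onD[OF inj] by auto
    have "dim (UNIV :: 'e set) = card E"
      using E(2) unfolding orthonormal_basis_def by (metis dim_eq_card span_UNIV)
    then have "dim (UNIV :: 'f set) = card (\<omega> ` E) + 1"
      using assms(7) by (simp add: card_image[OF inj])
    then obtain n where n: "n \<notin> \<omega> ` E" "\<And>e. e \<in> \<omega> ` E \<Longrightarrow> hu n e = 0"
        "orthonormal_basis hu (insert n (\<omega> ` E))"
      using orthonormal_unit_normal[OF finB form(4) on'] by blast
    let ?q = "\<phi> p"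
    \<comment> \<open>Testing \<open>T\<close> against left invariant fields moves the covariant
      derivatives on \<open>H\<close> to brackets at the unit.\<close>
    have T: "h ?q T (Y w ?q) = (\<Sum>e\<in>E. hu (\<omega> e) (lie_ad H B w (\<omega> e))
        - h ?q (differential A B \<phi> p (DX (\<epsilon> e) p)) (Y w ?q))" for w
    proof -
      have "h ?q (second_fundamental_form A g B h \<phi> p e e) (Y w ?q) = hu (\<omega> e) (lie_ad H B w (\<omega> e))
        - h ?q (differential A B \<phi> p (DX (\<epsilon> e) p)) (Y w ?q)" for e
        using II[of p "\<epsilon> e"] unfolding \<epsilon> by (simp add: linear_diff[OF inner_form_linear(2)[OF form(2)]] kY \<omega>_def)
      then show ?thesis unfolding E(3) by (simp add: linear_sum[OF inner_form_linear(2)[OF form(2)]])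
    qed
    have tangential: "h ?q T (Y (\<xi> u) ?q) = 0" for u
    proof -
      \<comment> \<open>For \<open>w = \<xi> u\<close> the Koszul formulas on \<open>G\<close> and
        on \<open>H\<close> give the same number, so every summand vanishes.\<close>
      have "h ?q (differential A B \<phi> p (DX (\<epsilon> e) p)) (Y (\<xi> u) ?q) = hu (\<omega> e) (lie_ad H B (\<xi> u) (\<omega> e))" for e
        unfolding \<omega>_def ad iso1 rel[symmetric] iso kX ..
      then show ?thesis by (simp add: T)
    qed
    have normal: "h ?q T (Y n ?q) = 0"
    proof -
      \<comment> \<open>Orthogonality of the normal field to the image is checked on
        \<open>E\<close> and extended by linearity to all tangent vectors at \<open>p\<close>, in
        particular to the covariant derivatives on \<open>G\<close>.\<close>
      have "linear (\<lambda>v. h ?q (differential A B \<phi> p v) (Y n ?q))"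
        using linear_compose[OF linear_differential[OF atlas \<phi>] inner_form_linear(2)[OF form(2)]]
        by (simp add: comp_def)
      moreover have "h ?q (differential A B \<phi> p e) (Y n ?q) = 0" if "e \<in> E" for e
        using n(2)[of "\<omega> e"] that rel[of p "\<epsilon> e"] hY[of ?q "\<omega> e" n] inner_form_commute[OF form(4)]
        unfolding \<epsilon> \<omega>_def by simp
      ultimately have "h ?q (differential A B \<phi> p v) (Y n ?q) = 0" if "v \<in> span E" for v
        using that by (rule linear_eq_0_on_span)
      then have "h ?q T (Y n ?q) = (\<Sum>f\<in>\<omega> ` E. hu f (lie_ad H B n f))"
        unfolding T spanE by (simp add: sum.reindex[OF inj])
      \<comment> \<open>The added summand is zero because \<open>lie_ad H B n n = 0\<close>; now the
        sum runs over a full orthonormal basis.\<close>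
      also have "\<dots> = (\<Sum>f\<in>insert n (\<omega> ` E). hu f (lie_ad H B n f))"
        using E(1) n(1) by (simp add: lie_ad_self[OF H'] linear_0[OF inner_form_linear(1)[OF form(4)]])
      also have "\<dots> = linear_trace (lie_ad H B n)"
        by (rule linear_trace_orthonormal[OF finB form(4) n(3) linear_lie_ad[OF H'], symmetric])
      also have "\<dots> = 0" using assms(6) unfolding unimodular_def by blast
      finally show ?thesis .
    qed
    \<comment> \<open>The images of \<open>E\<close> together with \<open>n\<close> span the Lie
      algebra of \<open>H\<close>, and left invariant fields take every value at \<open>?q\<close>,
      so \<open>T\<close> is orthogonal to everything.\<close>
    have "linear (\<lambda>w. h ?q T (Y w ?q))"
      using linear_compose[OF linear_left_invariant_field[OF H'] inner_form_linear(1)[OF form(2)]]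
      unfolding Y_def by (simp add: comp_def)
    moreover have "h ?q T (Y f ?q) = 0" if "f \<in> insert n (\<omega> ` E)" for f
      using that normal tangential unfolding \<omega>_def by blast
    ultimately have "h ?q T (Y w ?q) = 0" if "w \<in> span (insert n (\<omega> ` E))" for w
      using that by (rule linear_eq_0_on_span)
    then have "h ?q T (Y w ?q) = 0" for w
      using n(3) by (simp add: orthonormal_basis_def)
    then have "h ?q T v = 0" for v
      using left_invariant_field_surj[OF H', of ?q v] unfolding Y_def by metis
    then show ?thesis unfolding T_def by (rule inner_form_eq_0[OF form(2)])
  qed
  then show ?thesis unfolding harmonic_map_def using \<phi> by blast
qed

end
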